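(* Let $D$ be a reduced $k$-crossing diagram of a knot $K$. If a balanced overlaid Tait graph for $D$ has a forcing edge, then $\mathrm{SNF}(K)$ has invariant factors $(1,\ldots,1,\det(K))$ and the coloring torsion module of $K$ is cyclic.
   Context: The faces of a knot diagram $D$ are the connected components of the complement in the plane of the underlying $4$-valent curve. $D$ is reduced if at each crossing the four surrounding corners belong to four distinct faces. A balanced overlaid Tait (BOT) graph of $D$ is the bipartite graph $\Gamma_D=(V,W,E)$ where $V$ is the set of crossings of $D$, $W$ is the set of all bounded faces of $D$ except one omitted bounded face, the omitted face being adjacent to the unbounded face (separated from it by a portion of an arc of $D$), and $xy\in E$ if and only if the crossing $x$ is incident to the face $y$. For a $k$-crossing diagram, $|V|=|W|=k$. A dimer covering of a graph is a set $m$ of edges such that each vertex is an endpoint of exactly one edge in $m$. An edge $e$ of a graph is a forcing edge if there is exactly one dimer covering of the graph containing $e$. Dehn relation at a crossing: if $f_1,f_2$ are the two faces on either side of the over strand just before the crossing and $f_3,f_4$ the two faces on either side of the over strand just after the crossing, the relation is $f_1+f_2=f_3+f_4$. The Dehn coloring module $\widetilde{\mathrm{Col}}(K)$ is the abelian group generated by the faces of $D$ subject to all Dehn relations over $\mathbb{Z}$, with the unbounded face set to $0$. It is isomorphic to the Fox coloring module (generated by arcs, with relation $2a=b+c$ at each crossing with over strand $a$ and under strands $b,c$), is independent of the diagram up to isomorphism, and has rank $1$. The coloring torsion module is its torsion subgroup $T(\widetilde{\mathrm{Col}}(K))$, and $\det(K)$ is the order of this torsion subgroup. Let $\widetilde{M}(D)$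 be the $k\times k$ integer matrix with one row for each crossing, one column for each face in $W$, and entries the coefficients in the Dehn relations (the columns for the unbounded face and the omitted face being dropped); it presents $T(\widetilde{\mathrm{Col}}(K))$. $\mathrm{SNF}(K)$ denotes the Smith normal form of such a presentation matrix: the diagonal matrix with invariant factors $s_1\mid s_2\mid\cdots\mid s_k$, $s_i=d_i/d_{i-1}$, where $d_i$ is the gcd of all $i\times i$ minors and $d_0=1$; thus $T(\widetilde{\mathrm{Col}}(K))\cong\bigoplus_i\mathbb{Z}/s_i$. *)

theory Defs
  imports
    "HOL-Analysis.Analysis"
    "HOL-Algebra.Free_Abelian_Groups"
    "HOL-Algebra.Elementary_Groups"
    "Jordan_Normal_Form.Determinant"
    "Jordan_Normal_Form.DL_Submatrix"
begin

section \<open>Knots and knot diagrams\<close>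

text \<open>
  A knot is given by a \<open>C\<^sup>1\<close> embedding of the circle \<open>\<real>/\<int>\<close> into \<open>\<real>\<^sup>3 = \<complex> \<times> \<real>\<close> with nowhere
  vanishing velocity. The plane of the diagram is \<open>\<complex>\<close> and the last coordinate is the height.
\<close>

type_synonym space_curve = "real \<Rightarrow> complex \<times> real"

definition knot :: "space_curve \<Rightarrow> bool" where
  "knot K \<longleftrightarrow>
     K C1_differentiable_on UNIV \<and>
     (\<forall>t. vector_derivative K (at t) \<noteq> 0) \<and>
     (\<forall>s t. K s = K t \<longleftrightarrow> s - t \<in> \<int>)"

definition plane_curve :: "space_curve \<Rightarrow> real \<Rightarrow> complex" where
  "plane_curve K t = fst (K t)"

definition height :: "space_curve \<Rightarrow> real \<Rightarrow> real" where
  "height K t = snd (K t)"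

definition velocity :: "space_curve \<Rightarrow> real \<Rightarrow> complex" where
  "velocity K t = vector_derivative (plane_curve K) (at t)"

definition crossings :: "space_curve \<Rightarrow> complex set" where
  "crossings K = {p. \<exists>s t. s - t \<notin> \<int> \<and> plane_curve K s = p \<and> plane_curve K t = p}"

text \<open>
  For a knot \<open>K\<close> with regular projection, the diagram of \<open>K\<close> is the plane curve together with the
  over/under information supplied by the heights at the crossings. Every knot diagram arises in
  this way, since any choice of over strands at the double points lifts to heights.
\<close>

definition regular_projection :: "space_curve \<Rightarrow> bool" where
  "regular_projection K \<longleftrightarrow>
     (\<forall>t. velocity K t \<noteq> 0) \<and>
     finite (crossings K) \<and>
     (\<forall>r s t. plane_curve K r = plane_curve K s \<longrightarrow> plane_curve K s = plane_curve K t \<longrightarrow>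
        r - s \<in> \<int> \<or> s - t \<in> \<int> \<or> r - t \<in> \<int>) \<and>
     (\<forall>s t. plane_curve K s = plane_curve K t \<longrightarrow> s - t \<notin> \<int> \<longrightarrow>
        \<not> collinear {0, velocity K s, velocity K t})"

definition over_under :: "space_curve \<Rightarrow> complex \<Rightarrow> real \<Rightarrow> real \<Rightarrow> bool" where
  "over_under K p t s \<longleftrightarrow>
     plane_curve K t = p \<and> plane_curve K s = p \<and> height K s < height K t"

definition faces :: "space_curve \<Rightarrow> complex set set" where
  "faces K = components (- range (plane_curve K))"

text \<open>
  Let \<open>u\<close> and \<open>w\<close> be the velocities of the over and the under strand at the crossing \<open>p\<close>. For
  \<open>a, b \<in> {1, -1}\<close>, \<open>corner K p a b\<close> is the face that occupies the corner at \<open>p\<close> spanned by \<open>a u\<close>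
  and \<open>b w\<close>. By transversality, the points \<open>p + r (a u + b w)\<close> with small \<open>r > 0\<close> avoid the curve,
  so this face exists and is unique when \<open>K\<close> is a knot with regular projection. The strands are
  oriented by the parametrization, hence \<open>a = -1\<close> means before the crossing and \<open>a = 1\<close> after it,
  along the over strand.
\<close>

definition corner :: "space_curve \<Rightarrow> complex \<Rightarrow> real \<Rightarrow> real \<Rightarrow> complex set" where
  "corner K p a b =
     (THE F. F \<in> faces K \<and>
        (\<exists>t s. over_under K p t s \<and>
           (\<forall>\<^sub>F r in at_right 0.
              p + r *\<^sub>R (a *\<^sub>R velocity K t + b *\<^sub>R velocity K s) \<in> F)))"

definition reduced_diagram :: "space_curve \<Rightarrow> bool" where
  "reduced_diagram K \<longleftrightarrow>
     (\<forall>p \<in> crossings K. inj_on (\<lambda>(a, b). corner K p a b) ({1, -1} \<times> {1, -1}))"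


section \<open>Balanced overlaid Tait graphs and dimer coverings\<close>

text \<open>Two faces are adjacent if a nondegenerate piece of the curve lies on the boundary of both.\<close>

definition adjacent_faces :: "space_curve \<Rightarrow> complex set \<Rightarrow> complex set \<Rightarrow> bool" where
  "adjacent_faces K F G \<longleftrightarrow>
     F \<in> faces K \<and> G \<in> faces K \<and> F \<noteq> G \<and>
     (\<exists>s t. s < t \<and> plane_curve K ` {s<..<t} \<subseteq> frontier F \<inter> frontier G)"

definition omissible_face :: "space_curve \<Rightarrow> complex set \<Rightarrow> bool" where
  "omissible_face K F0 \<longleftrightarrow>
     F0 \<in> faces K \<and> bounded F0 \<and> (\<exists>U. \<not> bounded U \<and> adjacent_faces K F0 U)"

definition BOT_faces :: "space_curve \<Rightarrow> complex set \<Rightarrow> complex set set" where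
  "BOT_faces K F0 = {F \<in> faces K. bounded F} - {F0}"

text \<open>
  A bipartite graph is a triple \<open>(V, W, E)\<close> with \<open>E \<subseteq> V \<times> W\<close>; the classes \<open>V\<close> and \<open>W\<close> have
  different types here, so they need not be disjoint as sets.
\<close>

type_synonym ('v, 'w) bigraph = "'v set \<times> 'w set \<times> ('v \<times> 'w) set"

definition BOT_graph :: "space_curve \<Rightarrow> complex set \<Rightarrow> (complex, complex set) bigraph" where
  "BOT_graph K F0 =
     (crossings K, BOT_faces K F0,
      {(p, F). p \<in> crossings K \<and> F \<in> BOT_faces K F0 \<and> p \<in> frontier F})"

definition dimer_covering :: "('v, 'w) bigraph \<Rightarrow> ('v \<times> 'w) set \<Rightarrow> bool" where
  "dimer_covering \<Gamma> m \<longleftrightarrow>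
     (case \<Gamma> of (V, W, E) \<Rightarrow>
        m \<subseteq> E \<and> (\<forall>v\<in>V. \<exists>!e. e \<in> m \<and> fst e = v) \<and> (\<forall>w\<in>W. \<exists>!e. e \<in> m \<and> snd e = w))"

definition forcing_edge :: "('v, 'w) bigraph \<Rightarrow> 'v \<times> 'w \<Rightarrow> bool" where
  "forcing_edge \<Gamma> e \<longleftrightarrow>
     (case \<Gamma> of (V, W, E) \<Rightarrow> e \<in> E \<and> (\<exists>!m. dimer_covering \<Gamma> m \<and> e \<in> m))"


section \<open>The Dehn coloring module\<close>

text \<open>
  The relation \<open>f\<^sub>1 + f\<^sub>2 = f\<^sub>3 + f\<^sub>4\<close> at the crossing \<open>p\<close>, as an element of the free abelian group on
  the faces; if a face occupies several corners, its coefficients add up.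
\<close>

definition dehn_relator :: "space_curve \<Rightarrow> complex \<Rightarrow> complex set \<Rightarrow>\<^sub>0 int" where
  "dehn_relator K p =
     frag_of (corner K p (-1) 1) + frag_of (corner K p (-1) (-1))
     - frag_of (corner K p 1 1) - frag_of (corner K p 1 (-1))"

definition coloring_module :: "space_curve \<Rightarrow> (complex set \<Rightarrow>\<^sub>0 int) set monoid" where
  "coloring_module K =
     (let A = free_Abelian_group (faces K)
      in A Mod generate A
           (dehn_relator K ` crossings K \<union> {frag_of U |U. U \<in> faces K \<and> \<not> bounded U}))"

definition torsion_subgroup :: "('a, 'b) monoid_scheme \<Rightarrow> ('a, 'b) monoid_scheme" where
  "torsion_subgroup G =
     G\<lparr>carrier := {x \<in> carrier G. \<exists>n::nat. n > 0 \<and> x [^]\<^bsub>G\<^esub> n = \<one>\<^bsub>G\<^esub>}\<rparr>"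

definition coloring_torsion_module :: "space_curve \<Rightarrow> (complex set \<Rightarrow>\<^sub>0 int) set monoid" where
  "coloring_torsion_module K = torsion_subgroup (coloring_module K)"

definition knot_det :: "space_curve \<Rightarrow> nat" where
  "knot_det K = card (carrier (coloring_torsion_module K))"


section \<open>Smith normal form\<close>

definition determinantal_divisor :: "int mat \<Rightarrow> nat \<Rightarrow> int" where
  "determinantal_divisor A i =
     Gcd {Determinant.det (submatrix A I J) | I J.
            I \<subseteq> {..<dim_row A} \<and> J \<subseteq> {..<dim_col A} \<and> card I = i \<and> card J = i}"

text \<open>
  With 0-based indices, the diagonal entry \<open>i\<close> is \<open>s\<^sub>i\<^sub>+\<^sub>1 = d\<^sub>i\<^sub>+\<^sub>1 / d\<^sub>i\<close>, which is an exact division.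
  If \<open>d\<^sub>i = 0\<close>, then also \<open>d\<^sub>i\<^sub>+\<^sub>1 = 0\<close>, and the convention \<open>0 div 0 = 0\<close> gives \<open>s\<^sub>i\<^sub>+\<^sub>1 = 0\<close>.
  The definition is meant for square matrices.
\<close>

definition smith_normal_form :: "int mat \<Rightarrow> int mat" where
  "smith_normal_form A =
     mat_diag (dim_row A) (\<lambda>i. determinantal_divisor A (Suc i) div determinantal_divisor A i)"

text \<open>
  The coefficient matrix of the Dehn relations, for some ordering \<open>ps\<close> of the crossings and some
  ordering \<open>fs\<close> of the bounded faces other than \<open>F0\<close>.
\<close>

definition is_dehn_matrix :: "space_curve \<Rightarrow> complex set \<Rightarrow> int mat \<Rightarrow> bool" where
  "is_dehn_matrix K F0 M \<longleftrightarrow>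
     (\<exists>ps fs. distinct ps \<and> set ps = crossings K \<and>
              distinct fs \<and> set fs = BOT_faces K F0 \<and>
              M = Matrix.mat (length ps) (length fs)
                    (\<lambda>(i, j). Poly_Mapping.lookup (dehn_relator K (ps ! i)) (fs ! j)))"

definition is_SNF_of_knot :: "space_curve \<Rightarrow> int mat \<Rightarrow> bool" where
  "is_SNF_of_knot K S \<longleftrightarrow>
     (\<exists>F0 M. omissible_face K F0 \<and> is_dehn_matrix K F0 M \<and> S = smith_normal_form M)"

end

theory Submission
  imports Defs "HOL-Algebra.Multiplicative_Group" "HOL-Library.Z2"
begin

text \<open>
  Let \<open>M\<close> be the Dehn matrix of the diagram for an omitted face \<open>F0\<close>. A
  forcing edge \<open>(p, F)\<close> makes the cofactor of \<open>M\<close> at \<open>(p,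
  F)\<close> a unit: in a reduced diagram the entries of \<open>M\<close> are
  \<open>\<plusminus>1\<close> at incident pairs and \<open>0\<close> elsewhere, so the nonzero
  terms in the permutation expansion of that cofactor are \<open>\<plusminus>1\<close> and
  correspond to the dimer coverings that contain \<open>(p, F)\<close>, of which there is exactly
  one (\<open>forcing_edge_cofactor\<close>). Hence the determinantal divisor
  \<open>d\<^sub>k\<^sub>-\<^sub>1\<close> is \<open>1\<close>, and the relations at the crossings
  other than \<open>p\<close> express every face by \<open>F\<close>, \<open>F0\<close> and the
  unbounded face.

  The coloring module has rank one, and the functional that splits off its free part is the
  checkerboard coloring \<open>g\<close>, which is \<open>0\<close> on the unbounded face,
  \<open>1\<close> on every omissible face and satisfies all Dehn relations because the two faces
  along a strand always have different colors. The torsion classes are those killed by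
  \<open>g\<close>; they are generated by the class of \<open>F - g(F) F0\<close>, whose order is
  \<open>\<bar>det M\<bar>\<close>, as the column of the adjugate at \<open>p\<close> shows
  (\<open>torsion_cyclic\<close>). A different omissible face changes \<open>M\<close> only by an
  invertible change of columns, since \<open>g\<close> is a linear relation between the columns of
  all bounded faces with coefficient \<open>1\<close> at both omitted faces
  (\<open>matrix_column_change\<close>). So the invariant factors do not depend on that choice.

  Two facts about the diagram remain: \<open>det M \<noteq> 0\<close>, and the existence of
  \<open>g\<close>. Both come from working modulo \<open>2\<close>, where a Dehn relation says
  that the four corners of a crossing sum to zero. Follow the curve and compare the labels of the
  faces on its two sides. By the relation, whether the labels agree does not change at a crossing,
  be it passed on the over strand or on the under strand. The curve is a single loop, so the
  labels agree everywhere or nowhere. If they agree everywhere, the labelling is constant, since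
  removing the finitely many crossings does not disconnect the plane
  (\<open>balanced_constant\<close>). It follows that no nonzero solution of the relations modulo
  \<open>2\<close> vanishes on both the unbounded and the omitted face, that is, \<open>det
  M\<close> is odd (\<open>det_odd\<close>). The adjugate of \<open>M\<close> then yields an
  integer solution of all Dehn relations with the odd value \<open>det M\<close> at
  \<open>F0\<close>; its labels modulo \<open>2\<close> agree nowhere along the curve, and they
  are \<open>g\<close> (\<open>checkerboard\<close>). The number of bounded faces, usually
  obtained from Euler's formula, is given here by a dimer covering.

  Near a point of the curve everything is seen in a chart \<open>(x, y) \<mapsto> \<gamma> (t + x)
  + \<delta> (s + y) - \<gamma> t\<close>, where \<open>\<delta>\<close> is the other strand at a
  crossing and a transversal line elsewhere. The strands through the point are the images of the
  coordinate axes, at a regular point of the real axis alone, so the faces at the point are those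
  that contain the images of the quadrants or half planes.
\<close>

section \<open>Adjugates and determinantal divisors\<close>

lemma adj_mat_index: "A \<in> carrier_mat n n \<Longrightarrow> i < n \<Longrightarrow> j < n \<Longrightarrow> adj_mat A $$ (i, j) = cofactor A j i"
  by (auto simp: adj_mat_def)

lemma sum_mult_adj:
  assumes "A \<in> carrier_mat n n" "i < n" "j < n"
  shows "(\<Sum>k<n. A $$ (i, k) * cofactor A j k) = (if i = j then Determinant.det A else 0)"
    and "(\<Sum>k<n. cofactor A k i * A $$ (k, j)) = (if i = j then Determinant.det A else 0)"
proof -
  have "(\<Sum>k<n. A $$ (i, k) * cofactor A j k) = (A * adj_mat A) $$ (i, j)"
    using assms adj_mat(1)[OF assms(1)]
    by (simp add: scalar_prod_def adj_mat_index atLeast0LessThan)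
  then show "(\<Sum>k<n. A $$ (i, k) * cofactor A j k) = (if i = j then Determinant.det A else 0)"
    using adj_mat(2)[OF assms(1)] assms by simp
  have "(\<Sum>k<n. cofactor A k i * A $$ (k, j)) = (adj_mat A * A) $$ (i, j)"
    using assms adj_mat(1)[OF assms(1)]
    by (simp add: scalar_prod_def adj_mat_index atLeast0LessThan)
  then show "(\<Sum>k<n. cofactor A k i * A $$ (k, j)) = (if i = j then Determinant.det A else 0)"
    using adj_mat(3)[OF assms(1)] assms by simp
qed

text \<open>
  The usual cancellation argument: both sides become \<open>det (A * B)\<close> times the identity
  after multiplication with \<open>A * B\<close>.
\<close>

lemma adj_mat_mult:
  fixes A B :: "'a::idom mat"
  assumes A: "A \<in> carrier_mat n n" and B: "B \<in> carrier_mat n n" and nz: "Determinant.det (A * B) \<noteq> 0"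
  shows "adj_mat (A * B) = adj_mat B * adj_mat A"
proof -
  let ?C = "A * B" and ?X = "adj_mat B * adj_mat A"
  note adjA = adj_mat[OF A] and adjB = adj_mat[OF B]
  have C: "?C \<in> carrier_mat n n" using A B by simp
  note adjC = adj_mat[OF C]
  have X: "?X \<in> carrier_mat n n" using adjA(1) adjB(1) by simp
  have "?X * ?C = adj_mat B * (adj_mat A * A) * B"
    using A B adjA(1) adjB(1) C by (simp add: assoc_mult_mat[of _ n n _ n _ n])
  also have "\<dots> = Determinant.det A \<cdot>\<^sub>m (adj_mat B * B)"
    unfolding adjA(3) using A B adjB(1)
    by (simp add: mult_smult_distrib[of _ n n _ n] mult_smult_assoc_mat[of _ n n _ n])
  also have "\<dots> = Determinant.det ?C \<cdot>\<^sub>m 1\<^sub>m n"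
    unfolding adjB(3) det_mult[OF A B] by (intro eq_matI) (auto simp: mult_ac)
  finally have "?X * (?C * adj_mat ?C) = Determinant.det ?C \<cdot>\<^sub>m adj_mat ?C"
    using X C adjC(1)
    by (simp add: mult_smult_assoc_mat[of _ n n _ n] flip: assoc_mult_mat[of _ n n _ n _ n])
  then have "Determinant.det ?C \<cdot>\<^sub>m ?X = Determinant.det ?C \<cdot>\<^sub>m adj_mat ?C"
    unfolding adjC(2) using X by (simp add: mult_smult_distrib[of _ n n _ n] right_mult_one_mat[OF X])
  then have "Determinant.det ?C * ?X $$ (i, j) = Determinant.det ?C * adj_mat ?C $$ (i, j)" if "i < n" "j < n" for i j
    using that X adjC(1) by (metis carrier_matD index_smult_mat(1))
  then have entry: "adj_mat ?C $$ (i, j) = ?X $$ (i, j)" if "i < n" "j < n" for i j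
    using nz that by (metis mult_left_cancel)
  show ?thesis
    by (rule eq_matI, rule entry) (use X adjC(1) in \<open>simp_all only: carrier_matD\<close>)
qed

text \<open>
  Cofactors are the entries of the adjugate, so by multiplicativity those of \<open>A * B\<close>
  are linear combinations of those of \<open>A\<close>. This transports a unit cofactor from one
  Dehn matrix to another.
\<close>

lemma dvd_cofactor_mult:
  fixes A B :: "'a::idom mat"
  assumes A: "A \<in> carrier_mat n n" and B: "B \<in> carrier_mat n n" and nz: "Determinant.det (A * B) \<noteq> 0"
    and d: "\<And>i j. i < n \<Longrightarrow> j < n \<Longrightarrow> d dvd cofactor A i j" and ij: "i < n" "j < n"
  shows "d dvd cofactor (A * B) i j"
proof -
  have "cofactor (A * B) i j = (adj_mat B * adj_mat A) $$ (j, i)"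
    using adj_mat_index[of "A * B" n j i] A B ij adj_mat_mult[OF A B nz] by simp
  also have "\<dots> = (\<Sum>k<n. adj_mat B $$ (j, k) * cofactor A i k)"
    using adj_mat(1)[OF A] adj_mat(1)[OF B] ij A
    by (simp add: scalar_prod_def adj_mat_index atLeast0LessThan)
  finally show ?thesis using d ij by (auto intro!: dvd_sum dvd_mult)
qed

text \<open>
  A cofactor as the determinant of a matrix of the original size. In this form its permutation
  expansion runs over full permutations, hence over dimer coverings, and the matrix has an integer
  inverse when the cofactor is a unit.
\<close>

definition pin_row :: "'a::comm_ring_1 mat \<Rightarrow> nat \<Rightarrow> nat \<Rightarrow> 'a mat" where
  "pin_row A i j = Matrix.mat (dim_row A) (dim_col A)
     (\<lambda>(i', j'). if i' = i then (if j' = j then 1 else 0) else A $$ (i', j'))"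

lemma det_pin_row:
  assumes A: "A \<in> carrier_mat n n" and "i < n" "j < n"
  shows "Determinant.det (pin_row A i j) = cofactor A i j"
proof -
  have carr: "pin_row A i j \<in> carrier_mat n n" using A by (simp add: pin_row_def)
  have del: "cofactor (pin_row A i j) i b = cofactor A i b" if "b < n" for b
  proof -
    have "mat_delete (pin_row A i j) i b = mat_delete A i b"
      using assms that unfolding mat_delete_def pin_row_def by (intro eq_matI) auto
    then show ?thesis by (simp add: cofactor_def)
  qed
  have "Determinant.det (pin_row A i j) = (\<Sum>b<n. if b = j then cofactor A i b else 0)"
    unfolding laplace_expansion_row[OF carr \<open>i < n\<close>]
    using assms del by (intro sum.cong) (auto simp: pin_row_def)
  then show ?thesis using \<open>j < n\<close> by simp
qed

text \<open>
  Reduction modulo \<open>2\<close> gives a singular matrix over a field, and a kernel vector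
  there is lifted to the integers.
\<close>

lemma even_det_kernel:
  fixes M :: "int mat"
  assumes M: "M \<in> carrier_mat n n" and ev: "even (Determinant.det M)"
  obtains u :: "nat \<Rightarrow> int" where "\<exists>j<n. odd (u j)" "\<And>i. i < n \<Longrightarrow> even (\<Sum>j<n. M $$ (i, j) * u j)"
proof -
  let ?h = "of_int :: int \<Rightarrow> bit"
  have h0: "?h x = 0 \<longleftrightarrow> even x" for x by (cases "even x") (auto elim!: evenE oddE)
  have "Determinant.det (map_mat ?h M) = ?h (Determinant.det M)" by (rule of_int_hom.hom_det)
  moreover have "?h (Determinant.det M) = 0" by (simp only: h0 ev)
  ultimately have d0: "Determinant.det (map_mat ?h M) = 0" by (rule trans)
  have "map_mat ?h M \<in> carrier_mat n n" using M by simp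
  from det_0_iff_vec_prod_zero_field[OF this, THEN iffD1, OF d0]
  obtain w where w: "w \<in> carrier_vec n" "w \<noteq> 0\<^sub>v n" "map_mat ?h M *\<^sub>v w = 0\<^sub>v n"
    by (elim exE conjE)
  define u :: "nat \<Rightarrow> int" where "u j = (if w $ j = 0 then 0 else 1)" for j
  have u: "?h (u j) = w $ j" for j by (simp add: u_def)
  show thesis
  proof (rule that)
    obtain j where "j < n" "w $ j \<noteq> 0" using w(1,2) by (metis carrier_vecD eq_vecI index_zero_vec)
    then show "\<exists>j<n. odd (u j)" by (auto simp: u_def)
    fix i assume i: "i < n"
    have "?h (\<Sum>j<n. M $$ (i, j) * u j) = (\<Sum>j<n. ?h (M $$ (i, j)) * w $ j)"
      by (simp only: of_int_sum of_int_mult u)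
    also have "\<dots> = (map_mat ?h M *\<^sub>v w) $ i"
      using M w(1) i by (simp add: scalar_prod_def atLeast0LessThan)
    also have "\<dots> = 0" using w(3) i by simp
    finally show "even (\<Sum>j<n. M $$ (i, j) * u j)" by (simp only: h0)
  qed
qed

text \<open>
  \<open>pick I\<close> enumerates \<open>I\<close> increasingly, so deleting the element at
  position \<open>a\<close> shifts the later ones by one.
\<close>

lemma pick_remove:
  assumes a: "a < card I" and m: "Suc m < card I"
  shows "pick (I - {pick I a}) m = pick I (if m < a then m else Suc m)"
proof -
  define n where "n = (if m < a then m else Suc m)"
  have fin: "finite I" using a by (metis card.infinite not_less_zero)
  have n: "n < card I" "n \<noteq> a" using m by (auto simp: n_def)
  have inI: "pick I n \<in> I" and cn: "card {x \<in> I. x < pick I n} = n"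
    using pick_in_set_le[OF n(1)] card_pick_le[OF n(1)] by auto
  have lt: "pick I a < pick I n \<longleftrightarrow> a < n" and ne: "pick I n \<noteq> pick I a"
    using n pick_mono_le[OF a, of n] pick_mono_le[OF n(1), of a] by (cases a n rule: linorder_cases; force)+
  have "card {x \<in> I - {pick I a}. x < pick I n} = m"
  proof (cases "m < a")
    case True
    then have "{x \<in> I - {pick I a}. x < pick I n} = {x \<in> I. x < pick I n}" using lt by (auto simp: n_def)
    then show ?thesis using cn True by (simp add: n_def)
  next
    case False
    then have "{x \<in> I - {pick I a}. x < pick I n} = {x \<in> I. x < pick I n} - {pick I a}" by auto
    moreover have "pick I a \<in> {x \<in> I. x < pick I n}"
      using lt False pick_in_set_le[OF a] by (auto simp: n_def)
    ultimately show ?thesis using cn False fin by (simp add: n_def)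
  qed
  moreover have "pick (I - {pick I a}) (card {x \<in> I - {pick I a}. x < pick I n}) = pick I n"
    by (rule pick_card_in_set) (use inI ne in simp)
  ultimately show ?thesis by (simp add: n_def)
qed

lemma dim_submatrix_subset:
  assumes "I \<subseteq> {..<dim_row A}" "J \<subseteq> {..<dim_col A}"
  shows "dim_row (submatrix A I J) = card I" "dim_col (submatrix A I J) = card J"
proof -
  have "{i. i < dim_row A \<and> i \<in> I} = I" "{j. j < dim_col A \<and> j \<in> J} = J" using assms by auto
  then show "dim_row (submatrix A I J) = card I" "dim_col (submatrix A I J) = card J"
    by (simp_all add: dim_submatrix)
qed

lemma submatrix_index_subset:
  assumes "I \<subseteq> {..<dim_row A}" "J \<subseteq> {..<dim_col A}" "i < card I" "j < card J"
  shows "submatrix A I J $$ (i, j) = A $$ (pick I i, pick J j)"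
  using submatrix_index[of i A I j J] dim_submatrix_subset[OF assms(1,2)] assms(3,4)
  by (simp add: dim_submatrix)

text \<open>
  Deleting a row and a column of a submatrix gives a submatrix again; this makes Laplace expansion
  applicable to minors.
\<close>

lemma mat_delete_submatrix:
  assumes I: "I \<subseteq> {..<dim_row A}" and J: "J \<subseteq> {..<dim_col A}" and ab: "a < card I" "b < card J"
  shows "mat_delete (submatrix A I J) a b = submatrix A (I - {pick I a}) (J - {pick J b})"
proof (rule eq_matI)
  have I': "I - {pick I a} \<subseteq> {..<dim_row A}" and J': "J - {pick J b} \<subseteq> {..<dim_col A}" using I J by auto
  have c: "card (I - {pick I a}) = card I - 1" "card (J - {pick J b}) = card J - 1"
    using pick_in_set_le[OF ab(1)] pick_in_set_le[OF ab(2)] by simp_all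
  show "dim_row (mat_delete (submatrix A I J) a b) = dim_row (submatrix A (I - {pick I a}) (J - {pick J b}))"
    "dim_col (mat_delete (submatrix A I J) a b) = dim_col (submatrix A (I - {pick I a}) (J - {pick J b}))"
    by (simp_all add: dim_submatrix_subset[OF I J] dim_submatrix_subset[OF I' J'] c)
  fix i j assume "i < dim_row (submatrix A (I - {pick I a}) (J - {pick J b}))"
    "j < dim_col (submatrix A (I - {pick I a}) (J - {pick J b}))"
  then have ij: "i < card I - 1" "j < card J - 1" by (simp_all add: dim_submatrix_subset[OF I' J'] c)
  show "mat_delete (submatrix A I J) a b $$ (i, j) = submatrix A (I - {pick I a}) (J - {pick J b}) $$ (i, j)"
    using ij ab unfolding mat_delete_def
    by (simp add: dim_submatrix_subset[OF I J] submatrix_index_subset[OF I J]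
        submatrix_index_subset[OF I' J'] c pick_remove)
qed

lemma pick_lessThan: "i < n \<Longrightarrow> pick {..<n} i = i"
  using pick_card_in_set[of i "{..<n}"] by (simp add: Collect_conj_eq lessThan_def[symmetric] min_absorb2 Int_absorb1 subset_eq)

lemma submatrix_full: "submatrix A {..<dim_row A} {..<dim_col A} = A"
  by (rule eq_matI) (simp_all add: dim_submatrix_subset submatrix_index_subset pick_lessThan)

lemma mat_delete_eq_submatrix:
  assumes "i < dim_row A" "j < dim_col A"
  shows "mat_delete A i j = submatrix A ({..<dim_row A} - {i}) ({..<dim_col A} - {j})"
  using mat_delete_submatrix[of "{..<dim_row A}" A "{..<dim_col A}" i j] assms
  by (simp add: submatrix_full pick_lessThan)

lemma determinantal_divisor_dvd:
  assumes "I \<subseteq> {..<dim_row A}" "J \<subseteq> {..<dim_col A}" "card I = i" "card J = i"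
  shows "determinantal_divisor A i dvd Determinant.det (submatrix A I J)"
  unfolding determinantal_divisor_def by (rule Gcd_dvd) (use assms in blast)

text \<open>
  Laplace expansion writes a minor of size \<open>i + 1\<close> as a combination of minors of size
  \<open>i\<close>.
\<close>

lemma determinantal_divisor_dvd_Suc: "determinantal_divisor A i dvd determinantal_divisor A (Suc i)"
  unfolding determinantal_divisor_def[of A "Suc i"]
proof (rule Gcd_greatest, clarify)
  fix I J assume IJ: "I \<subseteq> {..<dim_row A}" "J \<subseteq> {..<dim_col A}" "card I = Suc i" "card J = Suc i"
  have carr: "submatrix A I J \<in> carrier_mat (Suc i) (Suc i)"
    using dim_submatrix_subset[OF IJ(1,2)] IJ(3,4) by auto
  have "determinantal_divisor A i dvd Determinant.det (mat_delete (submatrix A I J) 0 b)" if b: "b < Suc i" for b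
  proof -
    have ab: "0 < card I" "b < card J" using IJ b by auto
    show ?thesis
      unfolding mat_delete_submatrix[OF IJ(1,2) ab]
      by (rule determinantal_divisor_dvd)
         (use IJ pick_in_set_le[OF ab(1)] pick_in_set_le[OF ab(2)] in \<open>auto simp: card_Diff_singleton_if\<close>)
  qed
  then show "determinantal_divisor A i dvd Determinant.det (submatrix A I J)"
    unfolding laplace_expansion_row[OF carr zero_less_Suc] cofactor_def by (intro dvd_sum dvd_mult) auto
qed

lemma determinantal_divisor_mono: "i \<le> j \<Longrightarrow> determinantal_divisor A i dvd determinantal_divisor A j"
  by (induction rule: dec_induct) (auto intro: dvd_trans determinantal_divisor_dvd_Suc)

lemma determinantal_divisor_nonneg: "0 \<le> determinantal_divisor A i"
  by (simp add: determinantal_divisor_def)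

lemma determinantal_divisor_full:
  assumes "A \<in> carrier_mat n n"
  shows "determinantal_divisor A n = \<bar>Determinant.det A\<bar>"
proof -
  have full: "I = {..<n}" if "I \<subseteq> {..<n}" "card I = n" for I :: "nat set"
    using that card_subset_eq[of "{..<n}" I] by simp
  have "{Determinant.det (submatrix A I J) | I J. I \<subseteq> {..<dim_row A} \<and> J \<subseteq> {..<dim_col A} \<and> card I = n \<and> card J = n}
      = {Determinant.det A}"
  proof (intro equalityI subsetI)
    have dA: "dim_row A = n" "dim_col A = n" using assms by auto
    fix x
    show "x \<in> {Determinant.det A}" if "x \<in> {Determinant.det (submatrix A I J) | I J.
        I \<subseteq> {..<dim_row A} \<and> J \<subseteq> {..<dim_col A} \<and> card I = n \<and> card J = n}"
    proof -
      have "x = Determinant.det (submatrix A {..<n} {..<n})" using that full dA by auto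
      then show ?thesis using submatrix_full[of A] dA by simp
    qed
    show "x \<in> {Determinant.det (submatrix A I J) | I J.
        I \<subseteq> {..<dim_row A} \<and> J \<subseteq> {..<dim_col A} \<and> card I = n \<and> card J = n}" if "x \<in> {Determinant.det A}"
      using that submatrix_full[of A] dA by (intro CollectI exI[of _ "{..<n}"]) simp
  qed
  then show ?thesis by (simp add: determinantal_divisor_def)
qed

text \<open>
  If the cofactors have no common divisor, then \<open>d\<^sub>n\<^sub>-\<^sub>1 = 1\<close>, and
  all earlier divisors divide it.
\<close>

lemma smith_normal_form_coprime_cofactors:
  assumes A: "A \<in> carrier_mat n n"
    and cof: "\<And>d. (\<And>i j. i < n \<Longrightarrow> j < n \<Longrightarrow> d dvd cofactor A i j) \<Longrightarrow> is_unit (d::int)"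
  shows "smith_normal_form A = mat_diag n (\<lambda>i. if Suc i = n then \<bar>Determinant.det A\<bar> else 1)"
proof (cases "n = 0")
  case True
  then show ?thesis using A by (auto simp: smith_normal_form_def mat_diag_def)
next
  case False
  have "is_unit (determinantal_divisor A (n - 1))"
  proof (rule cof)
    fix i j assume ij: "i < n" "j < n"
    have dA: "dim_row A = n" "dim_col A = n" using A by auto
    have "determinantal_divisor A (n - 1) dvd Determinant.det (mat_delete A i j)"
      unfolding mat_delete_eq_submatrix[of i A j, unfolded dA, OF ij]
      by (rule determinantal_divisor_dvd) (use ij dA in \<open>auto simp: card_Diff_singleton_if\<close>)
    then show "determinantal_divisor A (n - 1) dvd cofactor A i j" by (simp add: cofactor_def)
  qed
  then have "determinantal_divisor A i = 1" if "i < n" for i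
  proof -
    have "determinantal_divisor A i dvd determinantal_divisor A (n - 1)"
      using that by (intro determinantal_divisor_mono) simp
    then have "is_unit (determinantal_divisor A i)"
      using \<open>is_unit (determinantal_divisor A (n - 1))\<close> dvd_trans by blast
    then show ?thesis using determinantal_divisor_nonneg[of A i] by simp
  qed
  then show ?thesis
    using A determinantal_divisor_full[OF A]
    by (intro eq_matI) (auto simp: smith_normal_form_def mat_diag_def less_Suc_eq)
qed

section \<open>Dimer coverings and cofactors\<close>

lemma dimer_covering_bij:
  assumes "dimer_covering (V, W, E) m" "E \<subseteq> V \<times> W"
  shows "bij_betw fst m V" "bij_betw snd m W"
proof -
  have m: "m \<subseteq> V \<times> W" "\<And>v. v \<in> V \<Longrightarrow> \<exists>!e. e \<in> m \<and> fst e = v" "\<And>w. w \<in> W \<Longrightarrow> \<exists>!e. e \<in> m \<and> snd e = w"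
    using assms by (auto simp: dimer_covering_def)
  have "inj_on fst m"
  proof (rule inj_onI)
    fix e e' assume "e \<in> m" "e' \<in> m" "fst e = fst e'"
    moreover from this have "fst e \<in> V" using m(1) by auto
    ultimately show "e = e'" using m(2)[of "fst e"] by metis
  qed
  moreover have "fst ` m = V" using m(1) ex1_implies_ex[OF m(2)] by force
  ultimately show "bij_betw fst m V" by (simp add: bij_betw_def)
  have "inj_on snd m"
  proof (rule inj_onI)
    fix e e' assume "e \<in> m" "e' \<in> m" "snd e = snd e'"
    moreover from this have "snd e \<in> W" using m(1) by auto
    ultimately show "e = e'" using m(3)[of "snd e"] by metis
  qed
  moreover have "snd ` m = W" using m(1) ex1_implies_ex[OF m(3)] by force
  ultimately show "bij_betw snd m W" by (simp add: bij_betw_def)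
qed

lemma dimer_coveringI:
  assumes "bij_betw fst m V" "bij_betw snd m W" "m \<subseteq> E"
  shows "dimer_covering (V, W, E) m"
proof -
  have "\<exists>!e. e \<in> m \<and> f e = x" if fX: "bij_betw f m X" "x \<in> X" for f and x :: 'c and X
  proof -
    obtain e where "e \<in> m" "f e = x" using fX unfolding bij_betw_def by auto
    then show ?thesis using fX(1) unfolding bij_betw_def by (metis inj_onD)
  qed
  from this[OF assms(1)] this[OF assms(2)] show ?thesis
    using assms(3) by (simp add: dimer_covering_def)
qed

text \<open>
  The determinant of \<open>pin_row M i j\<close> is a signed sum over the permutations
  \<open>\<pi>\<close> with \<open>\<pi> i = j\<close>. A term is nonzero exactly if the edges
  \<open>(ps ! i', fs ! \<pi> i')\<close> all belong to the graph, and then they form a dimer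
  covering that contains the chosen edge. For a forcing edge one term survives.
\<close>

lemma forcing_edge_cofactor:
  fixes M :: "int mat"
  assumes ps: "distinct ps" "set ps = V" "length ps = n"
    and fs: "distinct fs" "set fs = W" "length fs = n"
    and M: "M \<in> carrier_mat n n" and E: "E \<subseteq> V \<times> W"
    and adj: "\<And>i j. i < n \<Longrightarrow> j < n \<Longrightarrow> (ps ! i, fs ! j) \<in> E \<Longrightarrow> \<bar>M $$ (i, j)\<bar> = 1"
    and nonadj: "\<And>i j. i < n \<Longrightarrow> j < n \<Longrightarrow> (ps ! i, fs ! j) \<notin> E \<Longrightarrow> M $$ (i, j) = 0"
    and e: "forcing_edge (V, W, E) e"
  obtains i j where "i < n" "j < n" "\<bar>cofactor M i j\<bar> = 1"
proof -
  have eE: "e \<in> E" and ex1: "\<exists>!m. dimer_covering (V, W, E) m \<and> e \<in> m"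
    using e by (auto simp: forcing_edge_def)
  obtain i0 j0 where ij: "i0 < n" "j0 < n" and e_eq: "e = (ps ! i0, fs ! j0)"
    using eE E ps fs by (metis SigmaE in_set_conv_nth subsetD)
  have psn: "ps ! i = ps ! i' \<longleftrightarrow> i = i'" and fsn: "fs ! i = fs ! i' \<longleftrightarrow> i = i'" if "i < n" "i' < n" for i i'
    using that ps fs by (simp_all add: nth_eq_iff_index_eq)
  define P where "P = {\<pi>. \<pi> permutes {0..<n} \<and> \<pi> i0 = j0 \<and> (\<forall>i<n. (ps ! i, fs ! \<pi> i) \<in> E)}"
  define D where "D \<pi> = (\<lambda>i. (ps ! i, fs ! \<pi> i)) ` {0..<n}" for \<pi>
  \<comment> \<open>The map \<open>D\<close> identifies \<open>P\<close> with the dimer coverings that contain \<open>e\<close>.\<close>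
  have D: "dimer_covering (V, W, E) (D \<pi>) \<and> e \<in> D \<pi>" if "\<pi> \<in> P" for \<pi>
  proof -
    have \<pi>: "\<pi> permutes {0..<n}" "\<pi> i0 = j0" "\<And>i. i < n \<Longrightarrow> (ps ! i, fs ! \<pi> i) \<in> E"
      using that by (auto simp: P_def)
    have lt: "\<pi> i < n" if "i < n" for i using permutes_in_image[OF \<pi>(1), of i] that by simp
    have inj: "\<pi> i = \<pi> i' \<longleftrightarrow> i = i'" for i i' using permutes_inj[OF \<pi>(1)] by (simp add: inj_eq)
    have "bij_betw fst (D \<pi>) V"
      unfolding bij_betw_def D_def using ps psn
      by (auto simp: inj_on_def image_image in_set_conv_nth image_iff)
    moreover have "bij_betw snd (D \<pi>) W"
    proof -
      have "snd ` D \<pi> = (\<lambda>j. fs ! j) ` (\<pi> ` {0..<n})" by (simp add: D_def image_image)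
      also have "\<dots> = W" using fs permutes_image[OF \<pi>(1)] by (auto simp: in_set_conv_nth)
      finally have "snd ` D \<pi> = W" .
      moreover have "inj_on snd (D \<pi>)" unfolding D_def inj_on_def using fsn lt inj by auto
      ultimately show ?thesis by (simp add: bij_betw_def)
    qed
    moreover have "D \<pi> \<subseteq> E" using \<pi>(3) by (auto simp: D_def)
    ultimately have "dimer_covering (V, W, E) (D \<pi>)" by (rule dimer_coveringI)
    then show ?thesis using ij(1) \<pi>(2) by (auto simp: D_def e_eq)
  qed
  have "\<exists>\<pi>. \<pi> \<in> P"
  proof -
    obtain m where m: "dimer_covering (V, W, E) m" "e \<in> m" using ex1 by blast
    note bij = dimer_covering_bij[OF m(1) E]
    have mE: "m \<subseteq> E" using m(1) by (simp add: dimer_covering_def)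
    have "\<exists>j. j < n \<and> (ps ! i, fs ! j) \<in> m" if "i < n" for i
    proof -
      have "ps ! i \<in> V" using ps that by auto
      then obtain w where w: "(ps ! i, w) \<in> m" using bij(1) unfolding bij_betw_def by force
      then have "w \<in> W" using mE E by auto
      then show ?thesis using w fs by (metis in_set_conv_nth)
    qed
    then obtain f where f: "\<And>i. i < n \<Longrightarrow> f i < n \<and> (ps ! i, fs ! f i) \<in> m" by metis
    have inj: "inj_on f {0..<n}"
    proof (rule inj_onI)
      fix i i' assume i: "i \<in> {0..<n}" "i' \<in> {0..<n}" "f i = f i'"
      then have "(ps ! i, fs ! f i) \<in> m" "(ps ! i', fs ! f i) \<in> m" using f by force+
      then have "ps ! i = ps ! i'" using bij(2) unfolding bij_betw_def inj_on_def by fastforce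
      then show "i = i'" using i psn by simp
    qed
    have "f ` {0..<n} = {0..<n}" by (rule endo_inj_surj) (use f inj in auto)
    then have "bij_betw f {0..<n} {0..<n}" using inj by (simp add: bij_betw_def)
    then have per: "restrict_id f {0..<n} permutes {0..<n}"
      by (rule permutes_restrict_id)
    have eval: "restrict_id f {0..<n} i = f i" if "i < n" for i using that by (simp add: restrict_id_def)
    have "(ps ! i0, fs ! f i0) = e"
      using f[OF ij(1)] m(2) bij(1) unfolding bij_betw_def inj_on_def by (metis e_eq fst_conv)
    then have "f i0 = j0" using e_eq fsn f ij by auto
    then show ?thesis using per eval ij f mE by (intro exI[of _ "restrict_id f {0..<n}"]) (auto simp: P_def)
  qed
  then obtain \<pi> where \<pi>: "\<pi> \<in> P" by blast
  have "\<pi>' = \<pi>" if \<pi>': "\<pi>' \<in> P" for \<pi>'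
  proof
    fix i
    have eq: "D \<pi>' = D \<pi>" using D[OF \<pi>] D[OF \<pi>'] ex1 by blast
    have p: "\<pi> permutes {0..<n}" "\<pi>' permutes {0..<n}" using \<pi> \<pi>' by (auto simp: P_def)
    show "\<pi>' i = \<pi> i"
    proof (cases "i < n")
      case True
      then have "(ps ! i, fs ! \<pi>' i) \<in> D \<pi>'" by (simp add: D_def)
      then have "(ps ! i, fs ! \<pi>' i) \<in> D \<pi>" by (simp only: eq)
      then obtain k where "k < n" "ps ! i = ps ! k" "fs ! \<pi>' i = fs ! \<pi> k" by (auto simp: D_def)
      then show ?thesis using True psn fsn permutes_in_image[OF p(1), of k] permutes_in_image[OF p(2), of i] by auto
    next
      case False
      then show ?thesis using p by (simp add: permutes_not_in)
    qed
  qed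
  then have P1: "P = {\<pi>}" using \<pi> by blast
  let ?B = "pin_row M i0 j0"
  let ?t = "\<lambda>p. signof p * (\<Prod>i = 0..<n. ?B $$ (i, p i))"
  have B: "?B \<in> carrier_mat n n" using M by (simp add: pin_row_def)
  have entry: "?B $$ (i, j) = (if i = i0 then (if j = j0 then 1 else 0) else M $$ (i, j))" if "i < n" "j < n" for i j
    using that M by (simp add: pin_row_def)
  have "?t p = 0" if p: "p permutes {0..<n}" "p \<notin> P" for p
  proof -
    have lt: "p i < n" if "i < n" for i using permutes_in_image[OF p(1), of i] that by simp
    obtain i where i: "i < n" "?B $$ (i, p i) = 0"
    proof (cases "p i0 = j0")
      case True
      then obtain i where i: "i < n" "(ps ! i, fs ! p i) \<notin> E" using p by (auto simp: P_def)
      then have "i \<noteq> i0" using eE e_eq True by auto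
      then show thesis using that[OF i(1)] i entry lt nonadj by simp
    next
      case False
      then show thesis using that[OF ij(1)] entry lt ij by simp
    qed
    then show ?thesis by (auto intro!: prod_zero)
  qed
  then have "Determinant.det ?B = (\<Sum>p\<in>P. ?t p)"
    unfolding det_def'[OF B]
    by (intro sum.mono_neutral_right finite_permutations) (auto simp: P_def)
  then have "Determinant.det ?B = ?t \<pi>" using P1 by simp
  moreover have "\<bar>?t \<pi>\<bar> = 1"
  proof -
    have p: "\<pi> permutes {0..<n}" "\<pi> i0 = j0" "\<And>i. i < n \<Longrightarrow> (ps ! i, fs ! \<pi> i) \<in> E"
      using \<pi> by (auto simp: P_def)
    have lt: "\<pi> i < n" if "i < n" for i using permutes_in_image[OF p(1), of i] that by simp
    have "\<bar>?B $$ (i, \<pi> i)\<bar> = 1" if "i < n" for i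
      using entry[OF that lt[OF that]] adj[OF that lt[OF that] p(3)[OF that]] p(2) by auto
    then have "(\<Prod>i = 0..<n. \<bar>?B $$ (i, \<pi> i)\<bar>) = 1" by (intro prod.neutral) simp
    then show ?thesis by (simp add: abs_mult abs_prod sign_def)
  qed
  ultimately have "\<bar>cofactor M i0 j0\<bar> = 1" using det_pin_row[OF M ij] by simp
  then show thesis using that ij by blast
qed

section \<open>Torsion in quotients of abelian groups\<close>

text \<open>
  The functional \<open>g\<close> detects torsion: it maps to the torsion-free group of integers,
  so it kills every torsion class, and the classes that it kills are multiples of that of
  \<open>\<tau>\<close>. The functional \<open>\<phi>\<close>, which is defined modulo
  \<open>d\<close> on the quotient, shows that the order of \<open>\<tau>\<close> is not smaller
  than \<open>d\<close>.
\<close>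

lemma (in comm_group) cyclic_torsion_of_quotient:
  fixes d :: nat
  assumes N: "subgroup N G"
    and g: "g \<in> hom G integer_group" "\<And>x. x \<in> N \<Longrightarrow> g x = 0"
    and \<phi>: "\<phi> \<in> hom G integer_group" "\<And>x. x \<in> N \<Longrightarrow> int d dvd \<phi> x"
    and \<tau>: "\<tau> \<in> carrier G" "g \<tau> = 0" "is_unit (\<phi> \<tau>)" "\<tau> [^] d \<in> N" and d: "d > 0"
    and gen: "\<And>x. x \<in> carrier G \<Longrightarrow> g x = 0 \<Longrightarrow> \<exists>n::int. x \<otimes> inv (\<tau> [^] n) \<in> N"
  shows "cyclic_group (torsion_subgroup (G Mod N)) \<and> card (carrier (torsion_subgroup (G Mod N))) = d"
proof -
  interpret N: normal N G using N by (rule subgroup_imp_normal)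
  interpret Q: comm_group "G Mod N" using N by (rule abelian_FactGroup)
  let ?Q = "G Mod N"
  define t where "t = N #> \<tau>"
  have hom: "(\<lambda>a. N #> a) \<in> hom G ?Q" by (rule N.r_coset_hom_Mod)
  have cQ: "carrier ?Q = (\<lambda>a. N #> a) ` carrier G" by (auto simp: FactGroup_def RCOSETS_def)
  have tQ: "t \<in> carrier ?Q" using \<tau>(1) by (simp add: cQ t_def)
  have one: "\<one>\<^bsub>?Q\<^esub> = N" by (simp add: FactGroup_def)
  have coset1: "N #> x = N \<longleftrightarrow> x \<in> N" if "x \<in> carrier G" for x
    using coset_join1[OF _ that N] coset_join2[OF that N] by blast
  have powN: "(N #> x) [^]\<^bsub>?Q\<^esub> (n::nat) = N #> (x [^] n)" "(N #> x) [^]\<^bsub>?Q\<^esub> (i::int) = N #> (x [^] i)"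
    if "x \<in> carrier G" for x n i
    using hom_nat_pow[OF hom that is_group Q.is_group] hom_int_pow[OF hom that is_group Q.is_group] by simp_all
  have gpow: "g (x [^] (n::nat)) = int n * g x" and \<phi>pow: "\<phi> (x [^] (n::nat)) = int n * \<phi> x"
    if "x \<in> carrier G" for x n
    using hom_nat_pow[OF g(1) that is_group group_integer_group]
      hom_nat_pow[OF \<phi>(1) that is_group group_integer_group] by simp_all
  have gpowi: "g (x [^] (n::int)) = n * g x" if "x \<in> carrier G" for x n
    using hom_int_pow[OF g(1) that is_group group_integer_group] by simp
  have td: "t [^]\<^bsub>?Q\<^esub> d = \<one>\<^bsub>?Q\<^esub>"
    using \<tau> coset1 by (simp add: t_def powN one)
  have "d dvd n" if "t [^]\<^bsub>?Q\<^esub> n = \<one>\<^bsub>?Q\<^esub>" for n :: nat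
  proof -
    have "\<tau> [^] n \<in> N" using that \<tau>(1) coset1 by (simp add: t_def powN one)
    then have "int d dvd int n * \<phi> \<tau>" using \<phi>(2) \<phi>pow[OF \<tau>(1)] by metis
    then show ?thesis using \<tau>(3) by (simp add: dvd_mult_unit_iff)
  qed
  then have "d dvd group.ord ?Q t" using Q.pow_ord_eq_1[OF tQ] by blast
  moreover have "group.ord ?Q t dvd d" using td Q.pow_eq_id[OF tQ] by blast
  ultimately have ord: "group.ord ?Q t = d" by (rule dvd_antisym[rotated])
  have tors: "carrier (torsion_subgroup ?Q) = range (\<lambda>n::int. t [^]\<^bsub>?Q\<^esub> n)"
  proof (intro equalityI subsetI)
    fix y assume "y \<in> carrier (torsion_subgroup ?Q)"
    then obtain x and n :: nat where x: "x \<in> carrier G" "y = N #> x" and n: "n > 0" "y [^]\<^bsub>?Q\<^esub> n = \<one>\<^bsub>?Q\<^esub>"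
      by (auto simp: torsion_subgroup_def cQ)
    have "x [^] n \<in> N" using n x coset1 by (simp add: powN one)
    then have "int n * g x = 0" using g(2) gpow[OF x(1)] by metis
    then have "g x = 0" using n by simp
    then obtain i :: int where i: "x \<otimes> inv (\<tau> [^] i) \<in> N" using gen x(1) by blast
    have "x \<in> N #> (\<tau> [^] i)"
      using i x(1) \<tau>(1) N.rcos_module[OF is_group, of "\<tau> [^] i" x] by simp
    then have "N #> x = N #> (\<tau> [^] i)"
      using repr_independence[OF _ _ N, of x "\<tau> [^] i"] \<tau>(1) by simp
    then show "y \<in> range (\<lambda>n::int. t [^]\<^bsub>?Q\<^esub> n)" using x \<tau>(1) by (auto simp: t_def powN)
  next
    fix y assume "y \<in> range (\<lambda>n::int. t [^]\<^bsub>?Q\<^esub> n)"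
    then obtain i :: int where y: "y = t [^]\<^bsub>?Q\<^esub> i" by blast
    have "y [^]\<^bsub>?Q\<^esub> d = (t [^]\<^bsub>?Q\<^esub> d) [^]\<^bsub>?Q\<^esub> i"
      unfolding y using tQ by (simp add: Q.int_pow_pow int_pow_int[symmetric] mult.commute)
    then have "y [^]\<^bsub>?Q\<^esub> d = \<one>\<^bsub>?Q\<^esub>" by (simp only: td Q.int_pow_one)
    then show "y \<in> carrier (torsion_subgroup ?Q)" using y tQ d by (auto simp: torsion_subgroup_def)
  qed
  have eq: "torsion_subgroup ?Q = subgroup_generated ?Q {t}"
  proof -
    have "carrier (subgroup_generated ?Q {t}) = range (\<lambda>n::int. t [^]\<^bsub>?Q\<^esub> n)"
      using tQ by (rule Q.carrier_subgroup_generated_by_singleton)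
    then show ?thesis
      using tors by (simp add: torsion_subgroup_def subgroup_generated_def)
  qed
  have "card (carrier (torsion_subgroup ?Q)) = card (generate ?Q {t})"
    using tQ by (simp add: eq carrier_subgroup_generated)
  then show ?thesis using Q.cyclic_group_generated[of t] Q.generate_pow_card[OF tQ] ord eq by simp
qed

section \<open>Integer labellings of generators\<close>

text \<open>
  The linear extension to the free abelian group of an integer labelling of its generators.
\<close>

definition evaluate :: "('a \<Rightarrow> int) \<Rightarrow> ('a \<Rightarrow>\<^sub>0 int) \<Rightarrow> int" where
  "evaluate X c = (\<Sum>F\<in>Poly_Mapping.keys c. Poly_Mapping.lookup c F * X F)"

lemma evaluate_superset:
  "finite S \<Longrightarrow> Poly_Mapping.keys c \<subseteq> S \<Longrightarrow> evaluate X c = (\<Sum>F\<in>S. Poly_Mapping.lookup c F * X F)"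
  unfolding evaluate_def by (rule sum.mono_neutral_left) (auto simp: in_keys_iff)

lemma evaluate_frag_of [simp]: "evaluate X (frag_of F) = X F"
  by (simp add: evaluate_def)

lemma evaluate_zero [simp]: "evaluate X 0 = 0"
  by (simp add: evaluate_def)

lemma evaluate_cmul [simp]: "evaluate X (frag_cmul k c) = k * evaluate X c"
proof -
  have "evaluate X (frag_cmul k c) = (\<Sum>F\<in>Poly_Mapping.keys c. Poly_Mapping.lookup (frag_cmul k c) F * X F)"
    by (rule evaluate_superset) (auto simp: keys_cmul)
  then show ?thesis by (simp add: evaluate_def sum_distrib_left mult.assoc)
qed

lemma evaluate_add [simp]: "evaluate X (c + d) = evaluate X c + evaluate X d"
proof -
  let ?S = "Poly_Mapping.keys c \<union> Poly_Mapping.keys d"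
  have "Poly_Mapping.keys (c + d) \<subseteq> ?S" by (rule keys_add)
  then show ?thesis
    using evaluate_superset[of ?S] by (simp add: lookup_add sum.distrib distrib_right)
qed

lemma evaluate_minus [simp]: "evaluate X (- c) = - evaluate X c"
  using evaluate_cmul[of X "-1" c] by simp

lemma evaluate_diff [simp]: "evaluate X (c - d) = evaluate X c - evaluate X d"
  using evaluate_add[of X c "- d"] by simp

lemma evaluate_sum [simp]: "evaluate X (sum c I) = (\<Sum>i\<in>I. evaluate X (c i))"
  by (induction I rule: infinite_finite_induct) simp_all

lemma evaluate_hom: "evaluate X \<in> hom (free_Abelian_group S) integer_group"
  by (auto simp: hom_def)

lemma extend_along_list:
  assumes "distinct xs"
  obtains X where "\<And>j. j < length xs \<Longrightarrow> X (xs ! j) = f j" "\<And>x. x \<notin> set xs \<Longrightarrow> X x = z x"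
proof -
  let ?X = "\<lambda>x. if x \<in> set xs then f (the_inv_into {..<length xs} ((!) xs) x) else z x"
  have inj: "inj_on ((!) xs) {..<length xs}" using assms by (simp add: inj_on_nth)
  show thesis
  proof (rule that[of ?X])
    show "?X (xs ! j) = f j" if "j < length xs" for j
      using the_inv_into_f_f[OF inj, of j] that by simp
  qed simp
qed

section \<open>Charts spanned by two transversal curves\<close>

definition sum_chart :: "(real \<Rightarrow> complex) \<Rightarrow> (real \<Rightarrow> complex) \<Rightarrow> real \<Rightarrow> real \<Rightarrow> complex \<Rightarrow> complex" where
  "sum_chart \<gamma> \<delta> t s z = \<gamma> (t + Re z) + \<delta> (s + Im z) - \<gamma> t"

lemma noncollinear_combination_eq_0:
  fixes u w :: complex
  assumes "\<not> collinear {0, u, w}" and "x *\<^sub>R u + y *\<^sub>R w = 0"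
  shows "x = 0 \<and> y = 0"
proof -
  have nz: "u \<noteq> 0" "w \<noteq> 0" and nc: "\<And>c. w \<noteq> c *\<^sub>R u"
    using assms(1) by (auto simp: collinear_lemma)
  have "y = 0"
  proof (rule ccontr)
    assume y: "y \<noteq> 0"
    have "y *\<^sub>R w = (- x) *\<^sub>R u"
      using assms(2) by (simp add: add_eq_0_iff)
    then have "(1 / y) *\<^sub>R (y *\<^sub>R w) = (1 / y) *\<^sub>R ((- x) *\<^sub>R u)"
      by simp
    then have "w = (- x / y) *\<^sub>R u"
      using y by simp
    then show False using nc by blast
  qed
  then show ?thesis using assms(2) nz by simp
qed

text \<open>
  The chart has derivative \<open>(x, y) \<mapsto> x \<gamma>' t + y \<delta>' s\<close> at the
  origin, which is invertible by transversality, so the inverse function theorem applies. The last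
  conclusion says that the ray with direction \<open>a \<gamma>' t + b \<delta>' s\<close>, seen
  in the chart, leaves the origin in direction \<open>(a, b)\<close>; it locates the ray in a
  quadrant.
\<close>

lemma transversal_sum_chart:
  fixes \<gamma> \<delta> \<gamma>' \<delta>' :: "real \<Rightarrow> complex"
  assumes \<gamma>: "\<And>x. (\<gamma> has_vector_derivative \<gamma>' x) (at x)" "continuous_on UNIV \<gamma>'"
    and \<delta>: "\<And>x. (\<delta> has_vector_derivative \<delta>' x) (at x)" "continuous_on UNIV \<delta>'"
    and meet: "\<delta> s = \<gamma> t" and transversal: "\<not> collinear {0, \<gamma>' t, \<delta>' s}"
  obtains U V g where "open U" "0 \<in> U" "open V" "homeomorphism U V (sum_chart \<gamma> \<delta> t s) g"
    "\<And>a b. ((\<lambda>r. g (\<gamma> t + r *\<^sub>R (a *\<^sub>R \<gamma>' t + b *\<^sub>R \<delta>' s))) has_vector_derivative Complex a b) (at 0)"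
proof -
  define f where "f = sum_chart \<gamma> \<delta> t s"
  define L where "L z h = Re h *\<^sub>R \<gamma>' (t + Re z) + Im h *\<^sub>R \<delta>' (s + Im z)" for z h
  define f' where "f' z = Blinfun (L z)" for z
  have bl: "bounded_linear (L z)" for z
    unfolding L_def
    by (intro bounded_linear_add bounded_linear_scaleR_const bounded_linear_Re bounded_linear_Im)
  have ap: "blinfun_apply (f' z) = L z" for z
    unfolding f'_def using bl by (rule bounded_linear_Blinfun_apply)
  have der: "(f has_derivative blinfun_apply (f' z)) (at z)" for z
  proof -
    have 1: "((\<lambda>z. \<gamma> (t + Re z)) has_derivative (\<lambda>h. Re h *\<^sub>R \<gamma>' (t + Re z))) (at z)"
      by (rule has_derivative_compose[of "\<lambda>z. t + Re z" Re, OF _ \<gamma>(1)[unfolded has_vector_derivative_def]])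
         (auto intro!: derivative_eq_intros)
    have 2: "((\<lambda>z. \<delta> (s + Im z)) has_derivative (\<lambda>h. Im h *\<^sub>R \<delta>' (s + Im z))) (at z)"
      by (rule has_derivative_compose[of "\<lambda>z. s + Im z" Im, OF _ \<delta>(1)[unfolded has_vector_derivative_def]])
         (auto intro!: derivative_eq_intros)
    show ?thesis
      unfolding ap L_def f_def sum_chart_def
      using has_derivative_diff[OF has_derivative_add[OF 1 2] has_derivative_const] by simp
  qed
  have cont: "continuous_on UNIV f'"
  proof (rule continuous_on_blinfun_componentwise)
    fix i :: complex
    show "continuous_on UNIV (\<lambda>x. blinfun_apply (f' x) i)"
      unfolding ap L_def
      by (intro continuous_intros continuous_on_compose2[OF \<gamma>(2)] continuous_on_compose2[OF \<delta>(2)]) auto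
  qed
  have inj0: "inj (L 0)"
  proof (rule linear_injective_0[THEN iffD2, rule_format])
    show "linear (L 0)" using bl by (rule bounded_linear.linear)
    show "h = 0" if "L 0 h = 0" for h
      using noncollinear_combination_eq_0[OF transversal, of "Re h" "Im h"] that
      by (simp add: L_def complex_eq_iff)
  qed
  obtain M where M: "linear M" "M \<circ> L 0 = id"
    using linear_injective_left_inverse[OF bounded_linear.linear[OF bl] inj0] by blast
  define invf where "invf = Blinfun M"
  have apM: "blinfun_apply invf = M"
    unfolding invf_def using M(1) by (simp add: bounded_linear_Blinfun_apply linear_conv_bounded_linear)
  have inv: "invf o\<^sub>L f' 0 = id_blinfun"
    using M(2) by (intro blinfun_eqI) (simp add: apM ap fun_eq_iff)
  obtain U V g g' where UV: "open U" "0 \<in> U" "open V" "f 0 \<in> V" "homeomorphism U V f g"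
      and g': "\<And>y. y \<in> V \<Longrightarrow> (g has_derivative (g' y)) (at y)"
              "\<And>y. y \<in> V \<Longrightarrow> g' y = Hilbert_Choice.inv (blinfun_apply (f'(g y)))"
    using inverse_function_theorem[OF open_UNIV der cont UNIV_I inv] by metis
  have f0: "f 0 = \<gamma> t" by (simp add: f_def sum_chart_def meet)
  have g0: "g (\<gamma> t) = 0"
    using UV by (metis f0 homeomorphism_def)
  show thesis
  proof (rule that)
    show "homeomorphism U V (sum_chart \<gamma> \<delta> t s) g" using UV(5) by (simp add: f_def)
    fix a b :: real
    let ?v = "a *\<^sub>R \<gamma>' t + b *\<^sub>R \<delta>' s"
    have "L 0 (Complex a b) = ?v" by (simp add: L_def)
    then have "g' (\<gamma> t) ?v = Complex a b"
      using g'(2)[of "\<gamma> t"] UV(4) inv_f_f[OF inj0, of "Complex a b"] by (simp add: f0 g0 ap)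
    moreover have "(g has_derivative (g' (\<gamma> t))) (at (\<gamma> t))" using g'(1) UV(4) f0 by simp
    then have "((\<lambda>r. g (\<gamma> t + r *\<^sub>R ?v)) has_derivative (\<lambda>r. g' (\<gamma> t) (r *\<^sub>R ?v))) (at 0)"
      by (intro has_derivative_compose[of "\<lambda>r. \<gamma> t + r *\<^sub>R ?v" "\<lambda>r. r *\<^sub>R ?v" 0 UNIV g])
         (auto intro!: derivative_eq_intros)
    moreover have "linear (g' (\<gamma> t))"
      using \<open>(g has_derivative (g' (\<gamma> t))) (at (\<gamma> t))\<close> has_derivative_linear by blast
    ultimately show "((\<lambda>r. g (\<gamma> t + r *\<^sub>R ?v)) has_vector_derivative Complex a b) (at 0)"
      unfolding has_vector_derivative_def by (simp add: linear_scale)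
  qed (use UV in auto)
qed

text \<open>
  Chart coordinates are the real and the imaginary part of a complex number, which keeps the chart
  a map between equal Euclidean spaces as the inverse function theorem requires.
\<close>

definition square :: "real \<Rightarrow> complex set" where
  "square \<eta> = {z. \<bar>Re z\<bar> < \<eta> \<and> \<bar>Im z\<bar> < \<eta>}"

lemma open_square: "open (square \<eta>)"
  unfolding square_def by (intro open_Collect_conj open_Collect_less continuous_intros)

lemma convex_square: "convex (square \<eta>)"
proof -
  have "square \<eta> = Re -` {-\<eta><..<\<eta>} \<inter> Im -` {-\<eta><..<\<eta>}"
    by (auto simp: square_def abs_less_iff)
  then show ?thesis
    by (auto intro!: convex_Int convex_linear_vimage bounded_linear.linear bounded_linear_Re bounded_linear_Im)
qed

lemma square_subset_open:
  assumes "open U" "0 \<in> U" obtains \<eta> where "\<eta> > 0" "square \<eta> \<subseteq> U"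
proof -
  obtain e where e: "e > 0" "ball 0 e \<subseteq> U" using assms by (meson openE)
  have "square (e/2) \<subseteq> ball 0 e"
  proof
    fix z assume "z \<in> square (e/2)"
    then show "z \<in> ball 0 e" using cmod_le[of z] by (simp add: square_def)
  qed
  then show thesis using e that[of "e/2"] by auto
qed

lemma square_mono: "\<eta> \<le> \<epsilon> \<Longrightarrow> square \<eta> \<subseteq> square \<epsilon>"
  by (auto simp: square_def)

lemma tendsto_imp_in_closure:
  assumes "(f \<longlongrightarrow> l) F" "F \<noteq> bot" "\<forall>\<^sub>F x in F. f x \<in> S"
  shows "l \<in> closure S"
  using assms by (intro Lim_in_closed_set[OF closed_closure _ assms(2,1)])
     (auto elim: eventually_mono intro: closure_subset[THEN subsetD])

lemma convex_sector: "convex {z \<in> square \<eta>. a * Re z > 0 \<and> b * Im z > 0}"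
proof -
  have "{z \<in> square \<eta>. a * Re z > 0 \<and> b * Im z > 0}
      = square \<eta> \<inter> ((\<lambda>z. a * Re z) -` {0<..} \<inter> (\<lambda>z. b * Im z) -` {0<..})" by auto
  then show ?thesis
    by (auto intro!: convex_square convex_Int convex_linear_vimage bounded_linear.linear
          bounded_linear_const_mult bounded_linear_Re bounded_linear_Im)
qed

lemma convex_half_square: "convex {z \<in> square \<eta>. b * Im z > 0}"
proof -
  have "{z \<in> square \<eta>. b * Im z > 0} = square \<eta> \<inter> ((\<lambda>z. b * Im z) -` {0<..})" by auto
  then show ?thesis
    by (auto intro!: convex_square convex_Int convex_linear_vimage bounded_linear.linear
          bounded_linear_const_mult bounded_linear_Im)
qed

section \<open>The diagram near a point of the curve\<close>

locale knot_diagram =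
  fixes K :: space_curve
  assumes knot: "knot K" and regular: "regular_projection K"
begin

abbreviation "\<gamma> \<equiv> plane_curve K"
abbreviation "v \<equiv> velocity K"

lemma has_velocity: "(\<gamma> has_vector_derivative v t) (at t)"
  and continuous_velocity: "continuous_on UNIV v"
proof -
  obtain D where D: "\<And>t. (K has_vector_derivative D t) (at t)" "continuous_on UNIV D"
    using knot by (auto simp: knot_def C1_differentiable_on_def)
  have 1: "(\<gamma> has_vector_derivative fst (D t)) (at t)" for t
    unfolding plane_curve_def[abs_def]
    using bounded_linear.has_vector_derivative[OF bounded_linear_fst D(1)] .
  then have 2: "v t = fst (D t)" for t
    by (simp add: velocity_def vector_derivative_at)
  show "(\<gamma> has_vector_derivative v t) (at t)" using 1 2 by simp
  show "continuous_on UNIV v"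
    unfolding 2[abs_def] by (intro continuous_intros D)
qed

lemma continuous_curve: "continuous_on S \<gamma>"
  by (meson continuous_at_imp_continuous_on has_vector_derivative_continuous has_velocity)

lemma curve_eq_iff: "K s = K t \<longleftrightarrow> s - t \<in> \<int>"
  using knot by (simp add: knot_def)

lemma curve_periodic: "s - t \<in> \<int> \<Longrightarrow> \<gamma> s = \<gamma> t"
  by (metis curve_eq_iff plane_curve_def)

lemma velocity_periodic: assumes "s - t \<in> \<int>" shows "v s = v t"
proof -
  have "((\<lambda>x. \<gamma> (x + (s - t))) has_vector_derivative v s) (at t)"
    using vector_diff_chain_at[of "\<lambda>x. x + (s - t)" 1 t \<gamma> "v s"] has_velocity[of s]
      has_vector_derivative_add[OF has_vector_derivative_id has_vector_derivative_const[of "s - t"]]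
    by (simp add: o_def)
  moreover have "(\<lambda>x. \<gamma> (x + (s - t))) = \<gamma>"
    using assms by (intro ext curve_periodic) simp
  ultimately show ?thesis
    using has_velocity[of t] vector_derivative_unique_at by metis
qed

lemma double_point: "\<gamma> s = \<gamma> t \<Longrightarrow> s - t \<notin> \<int> \<Longrightarrow> \<gamma> r = \<gamma> t \<Longrightarrow> r - s \<in> \<int> \<or> r - t \<in> \<int>"
  using regular unfolding regular_projection_def by metis

lemma range_curve: "range \<gamma> = \<gamma> ` {0..1}"
proof -
  have "\<gamma> x \<in> \<gamma> ` {0..1}" for x
    using curve_periodic[of x "frac x"] frac_lt_1[of x] by (auto simp: frac_def intro!: image_eqI[of _ _ "frac x"])
  then show ?thesis by auto
qed

lemma compact_range: "compact (range \<gamma>)"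
  unfolding range_curve by (intro compact_continuous_image continuous_curve) simp

lemma open_complement: "open (- range \<gamma>)"
  using compact_range compact_imp_closed open_Compl by blast

lemma face_open: "F \<in> faces K \<Longrightarrow> open F"
  unfolding faces_def using open_components open_complement by blast

lemma face_eqI: "F \<in> faces K \<Longrightarrow> G \<in> faces K \<Longrightarrow> z \<in> F \<Longrightarrow> z \<in> G \<Longrightarrow> F = G"
  unfolding faces_def using components_nonoverlap by fastforce

lemma face_off_curve: "F \<in> faces K \<Longrightarrow> z \<in> F \<Longrightarrow> z \<notin> range \<gamma>"
  unfolding faces_def using in_components_subset by blast

lemma face_nonempty: "F \<in> faces K \<Longrightarrow> F \<noteq> {}"
  unfolding faces_def using in_components_nonempty by blast

lemma connected_in_face:
  assumes "connected S" "S \<noteq> {}" "S \<inter> range \<gamma> = {}"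
  shows "\<exists>F \<in> faces K. S \<subseteq> F"
  unfolding faces_def using exists_component_superset[of S "- range \<gamma>"] assms by blast

text \<open>
  Times that stay away from \<open>T\<close> modulo the period form a compact set, so the curve
  has a positive distance from \<open>p\<close> there.
\<close>

lemma curve_return:
  assumes T: "\<And>x. \<gamma> x = p \<Longrightarrow> \<exists>t\<in>T. x - t \<in> \<int>" and "\<epsilon> > 0"
  obtains e where "e > 0" "\<And>x. dist (\<gamma> x) p < e \<Longrightarrow> \<exists>t\<in>T. \<exists>y. x - y \<in> \<int> \<and> \<bar>y - t\<bar> < \<epsilon>"
proof -
  define J where "J = (\<Union>t\<in>T. \<Union>n::int. ball (t + of_int n) \<epsilon>)"
  have J: "x \<in> J \<longleftrightarrow> (\<exists>t\<in>T. \<exists>y. x - y \<in> \<int> \<and> \<bar>y - t\<bar> < \<epsilon>)" for x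
  proof
    assume "x \<in> J"
    then obtain t and n :: int where "t \<in> T" "x \<in> ball (t + of_int n) \<epsilon>" by (auto simp: J_def)
    then show "\<exists>t\<in>T. \<exists>y. x - y \<in> \<int> \<and> \<bar>y - t\<bar> < \<epsilon>"
      by (intro bexI[of _ t] exI[of _ "x - of_int n"]) (auto simp: dist_real_def abs_minus_commute algebra_simps)
  next
    assume "\<exists>t\<in>T. \<exists>y. x - y \<in> \<int> \<and> \<bar>y - t\<bar> < \<epsilon>"
    then obtain t y n where "t \<in> T" "x - y = of_int n" "\<bar>y - t\<bar> < \<epsilon>" by (auto elim!: Ints_cases)
    then have "x \<in> ball (t + of_int n) \<epsilon>" by (simp add: dist_real_def abs_if split: if_splits)
    then show "x \<in> J" using \<open>t \<in> T\<close> by (auto simp: J_def)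
  qed
  have "open J" by (auto simp: J_def)
  then have "compact ({0..1} - J)" by (simp add: compact_diff)
  then have cl: "closed (\<gamma> ` ({0..1} - J))"
    by (intro compact_imp_closed compact_continuous_image continuous_curve)
  have "p \<notin> \<gamma> ` ({0..1} - J)"
  proof
    assume "p \<in> \<gamma> ` ({0..1} - J)"
    then obtain x where "p = \<gamma> x" "x \<notin> J" by blast
    with T[of x] \<open>\<epsilon> > 0\<close> show False unfolding J by (metis abs_zero cancel_comm_monoid_add_class.diff_cancel)
  qed
  then obtain e where e: "e > 0" "ball p e \<inter> \<gamma> ` ({0..1} - J) = {}"
    using cl by (metis Compl_iff disjoint_eq_subset_Compl open_Compl openE)
  show thesis
  proof (rule that[OF e(1)])
    fix x assume d: "dist (\<gamma> x) p < e"
    have xf: "x - frac x \<in> \<int>" by (simp add: frac_def)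
    have "frac x \<in> J"
    proof (rule ccontr)
      assume "frac x \<notin> J"
      then have "\<gamma> (frac x) \<in> \<gamma> ` ({0..1} - J)" using frac_lt_1[of x] by force
      then show False using e(2) d curve_periodic[OF xf] by (auto simp: dist_commute)
    qed
    then obtain t y where "t \<in> T" "frac x - y \<in> \<int>" "\<bar>y - t\<bar> < \<epsilon>" unfolding J by blast
    moreover have "x - y = (x - frac x) + (frac x - y)" by simp
    ultimately show "\<exists>t\<in>T. \<exists>y. x - y \<in> \<int> \<and> \<bar>y - t\<bar> < \<epsilon>" using xf Ints_add by metis
  qed
qed

text \<open>
  A common description for regular points (\<open>C = False\<close>, \<open>\<delta>\<close> an
  auxiliary transversal line) and crossings (\<open>C = True\<close>, \<open>\<delta> =
  \<gamma>\<close> the other strand). In a small chart the curve is the real axis, together with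
  the imaginary axis at a crossing: other parts of the curve stay away by compactness, and the
  strands meet the image of the small square only along the axes because the chart is injective on
  a larger square.
\<close>

lemma curve_in_transversal_chart:
  fixes \<delta> \<delta>' :: "real \<Rightarrow> complex" and C :: bool
  assumes \<delta>: "\<And>x. (\<delta> has_vector_derivative \<delta>' x) (at x)" "continuous_on UNIV \<delta>'"
    and meet: "\<delta> s = \<gamma> t" and transversal: "\<not> collinear {0, v t, \<delta>' s}"
    and ret: "\<And>x. \<gamma> x = \<gamma> t \<Longrightarrow> x - t \<in> \<int> \<or> C \<and> x - s \<in> \<int>"
    and C: "C \<Longrightarrow> \<delta> = \<gamma>"
  obtains \<eta> where "\<eta> > 0" "continuous_on (square \<eta>) (sum_chart \<gamma> \<delta> t s)"
    "\<And>S. open S \<Longrightarrow> S \<subseteq> square \<eta> \<Longrightarrow> open (sum_chart \<gamma> \<delta> t s ` S)"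
    "\<And>z. z \<in> square \<eta> \<Longrightarrow> sum_chart \<gamma> \<delta> t s z \<in> range \<gamma> \<longleftrightarrow> Im z = 0 \<or> C \<and> Re z = 0"
    "\<And>a b. a \<noteq> 0 \<Longrightarrow> b \<noteq> 0 \<Longrightarrow> \<forall>\<^sub>F r in at_right 0. \<gamma> t + r *\<^sub>R (a *\<^sub>R v t + b *\<^sub>R \<delta>' s)
        \<in> sum_chart \<gamma> \<delta> t s ` {z \<in> square \<eta>. a * Re z > 0 \<and> b * Im z > 0}"
proof -
  let ?f = "sum_chart \<gamma> \<delta> t s" and ?p = "\<gamma> t"
  obtain U V g where UV: "open U" "0 \<in> U" "open V" "homeomorphism U V ?f g"
    and g: "\<And>a b. ((\<lambda>r. g (?p + r *\<^sub>R (a *\<^sub>R v t + b *\<^sub>R \<delta>' s))) has_vector_derivative Complex a b) (at 0)"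
    using transversal_sum_chart[OF has_velocity continuous_velocity \<delta> meet transversal] by metis
  obtain \<epsilon> where \<epsilon>: "\<epsilon> > 0" "square \<epsilon> \<subseteq> U" using square_subset_open UV by metis
  have f0: "?f 0 = ?p" by (simp add: sum_chart_def meet)
  have cU: "continuous_on U ?f" and inj: "inj_on ?f U" and fU: "?f ` U = V"
    using UV(4) by (auto simp: homeomorphism_def inj_on_def) metis
  have pV: "?p \<in> V" using f0 fU UV(2) by force
  have g0: "g ?p = 0" using UV(4,2) f0 by (metis homeomorphism_def)
  define T where "T = (if C then {t, s} else {t})"
  obtain e where e: "e > 0" "\<And>x. dist (\<gamma> x) ?p < e \<Longrightarrow> \<exists>t\<in>T. \<exists>y. x - y \<in> \<int> \<and> \<bar>y - t\<bar> < \<epsilon>"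
  proof (rule curve_return)
    show "\<exists>t\<in>T. x - t \<in> \<int>" if "\<gamma> x = ?p" for x using ret[OF that] by (auto simp: T_def)
  qed (use \<epsilon> in auto)
  have "open (U \<inter> ?f -` ball ?p e)"
    by (intro continuous_open_preimage cU UV) auto
  then obtain \<eta>' where \<eta>': "\<eta>' > 0" "square \<eta>' \<subseteq> U \<inter> ?f -` ball ?p e"
    using square_subset_open[of "U \<inter> ?f -` ball ?p e"] UV(2) e(1) f0 by auto
  define \<eta> where "\<eta> = min \<eta>' \<epsilon>"
  have \<eta>: "\<eta> > 0" "square \<eta> \<subseteq> square \<epsilon>" "square \<eta> \<subseteq> U" "\<And>z. z \<in> square \<eta> \<Longrightarrow> ?f z \<in> ball ?p e"
    using \<eta>' \<epsilon> square_mono[of \<eta> \<eta>'] square_mono[of \<eta> \<epsilon>] by (auto simp: \<eta>_def)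
  show thesis
  proof (rule that[OF \<eta>(1)])
    show "continuous_on (square \<eta>) ?f" using cU \<eta>(3) continuous_on_subset by blast
    show "open (?f ` S)" if "open S" "S \<subseteq> square \<eta>" for S
    proof -
      have "openin (top_of_set V) (?f ` S)"
        using homeomorphism_imp_open_map[OF UV(4)] that \<eta>(3) by (metis openin_open_eq UV(1) subset_trans)
      then show ?thesis using UV(3) openin_open_trans by blast
    qed
    show "?f z \<in> range \<gamma> \<longleftrightarrow> Im z = 0 \<or> C \<and> Re z = 0" if z: "z \<in> square \<eta>" for z
    proof
      assume "Im z = 0 \<or> C \<and> Re z = 0"
      then show "?f z \<in> range \<gamma>" using C meet by (auto simp: sum_chart_def)
    next
      assume "?f z \<in> range \<gamma>"
      then obtain x where x: "?f z = \<gamma> x" by blast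
      then have "dist (\<gamma> x) ?p < e" using \<eta>(4)[OF z] by (simp add: dist_commute)
      then obtain t' y where y: "t' \<in> T" "x - y \<in> \<int>" "\<bar>y - t'\<bar> < \<epsilon>" using e(2) by blast
      have fz: "?f z = \<gamma> y" using x curve_periodic[OF y(2)] by simp
      have zU: "z \<in> U" using z \<eta> by blast
      show "Im z = 0 \<or> C \<and> Re z = 0"
      proof (cases "t' = t")
        case True
        let ?w = "Complex (y - t) 0"
        have "?w \<in> U" using \<epsilon> y(3) True by (auto simp: square_def)
        moreover have "?f ?w = \<gamma> y" by (simp add: sum_chart_def meet)
        ultimately have "z = ?w" using inj fz zU by (metis inj_onD)
        then show ?thesis by simp
      next
        case False
        then have "C" "t' = s" using y(1) by (auto simp: T_def split: if_splits)
        let ?w = "Complex 0 (y - s)"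
        have "?w \<in> U" using \<epsilon> y(3) \<open>t' = s\<close> by (auto simp: square_def)
        moreover have "?f ?w = \<gamma> y" using C[OF \<open>C\<close>] by (simp add: sum_chart_def)
        ultimately have "z = ?w" using inj fz zU by (metis inj_onD)
        then show ?thesis using \<open>C\<close> by simp
      qed
    qed
    fix a b :: real assume ab: "a \<noteq> 0" "b \<noteq> 0"
    let ?l = "\<lambda>r. ?p + r *\<^sub>R (a *\<^sub>R v t + b *\<^sub>R \<delta>' s)"
    have der: "((\<lambda>r. g (?l r)) has_vector_derivative Complex a b) (at 0)" by (rule g)
    have evV: "\<forall>\<^sub>F r in at_right 0. ?l r \<in> V"
    proof (rule topological_tendstoD[OF _ UV(3) pV])
      show "(?l \<longlongrightarrow> ?p) (at_right 0)" by (auto intro!: tendsto_eq_intros)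
    qed
    have "isCont (\<lambda>r. g (?l r)) 0" using der by (rule has_vector_derivative_continuous)
    then have lim: "((\<lambda>r. g (?l r)) \<longlongrightarrow> 0) (at_right 0)"
      using g0 by (simp add: isCont_def filterlim_at_split)
    have ev\<eta>: "\<forall>\<^sub>F r in at_right 0. g (?l r) \<in> square \<eta>"
      by (rule topological_tendstoD[OF lim open_square]) (use \<eta>(1) in \<open>simp add: square_def\<close>)
    have pos: "\<forall>\<^sub>F r in at_right 0. h (g (?l r)) > 0"
      if "bounded_linear h" "h (Complex a b) > 0" for h :: "complex \<Rightarrow> real"
    proof -
      have "((\<lambda>r. h (g (?l r))) has_vector_derivative h (Complex a b)) (at 0)"
        using bounded_linear.has_vector_derivative[OF that(1) der] .
      then have "DERIV (\<lambda>r. h (g (?l r))) 0 :> h (Complex a b)"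
        by (simp add: has_real_derivative_iff_has_vector_derivative)
      from has_real_derivative_pos_inc_right[OF this that(2)]
      obtain d where d: "d > 0" "\<And>r. 0 < r \<Longrightarrow> r < d \<Longrightarrow> h (g (?l 0)) < h (g (?l r))" by auto
      moreover have "h (g (?l 0)) = 0" using g0 that(1) by (simp add: linear_0 bounded_linear.linear)
      ultimately show ?thesis unfolding eventually_at_right_field by auto
    qed
    have evR: "\<forall>\<^sub>F r in at_right 0. a * Re (g (?l r)) > 0"
      using pos[of "\<lambda>z. a * Re z"] ab
      by (auto simp: bounded_linear_const_mult bounded_linear_Re zero_less_mult_iff linorder_neq_iff)
    have evI: "\<forall>\<^sub>F r in at_right 0. b * Im (g (?l r)) > 0"
      using pos[of "\<lambda>z. b * Im z"] ab
      by (auto simp: bounded_linear_const_mult bounded_linear_Im zero_less_mult_iff linorder_neq_iff)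
    from evV ev\<eta> evR evI
    show "\<forall>\<^sub>F r in at_right 0. ?l r \<in> ?f ` {z \<in> square \<eta>. a * Re z > 0 \<and> b * Im z > 0}"
    proof eventually_elim
      case (elim r)
      moreover have "?l r = ?f (g (?l r))" using elim(1) UV(4) by (simp add: homeomorphism_def)
      ultimately show ?case by blast
    qed
  qed
qed


text \<open>
  Near \<open>q\<close>, the complement of the curve lies in \<open>F\<close> and
  \<open>G\<close>, and both come arbitrarily close to \<open>q\<close>. The unordered pair of
  faces on the two sides is determined by \<open>q\<close>, so no orientation has to be chosen;
  \<open>F = G\<close> is allowed.
\<close>

definition two_sided :: "complex \<Rightarrow> complex set \<Rightarrow> complex set \<Rightarrow> bool" where
  "two_sided q F G \<longleftrightarrow> F \<in> faces K \<and> G \<in> faces K \<and> q \<in> closure F \<and> q \<in> closure G \<and>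
     (\<exists>N. open N \<and> q \<in> N \<and> N - range \<gamma> \<subseteq> F \<union> G)"

lemma two_sided_face:
  assumes "two_sided q F G" "H \<in> faces K" "q \<in> closure H" shows "H = F \<or> H = G"
proof -
  obtain N where N: "open N" "q \<in> N" "N - range \<gamma> \<subseteq> F \<union> G" and FG: "F \<in> faces K" "G \<in> faces K"
    using assms(1) unfolding two_sided_def by blast
  obtain z where "z \<in> N" "z \<in> H" using assms(3) N closure_iff_nhds_not_empty by blast
  then show ?thesis using N(3) face_off_curve[OF assms(2)] face_eqI FG assms(2) by blast
qed

lemma two_sided_unique:
  assumes "two_sided q F G" "two_sided q F' G'" shows "{F, G} = {F', G'}"
proof -
  have 1: "F' \<in> {F, G}" "G' \<in> {F, G}"
    using two_sided_face[OF assms(1)] assms(2) by (auto simp: two_sided_def)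
  have 2: "F \<in> {F', G'}" "G \<in> {F', G'}"
    using two_sided_face[OF assms(2)] assms(1) by (auto simp: two_sided_def)
  show ?thesis using 1 2 by auto
qed

text \<open>
  In a chart region where the curve is the zero set of a linear functional \<open>l\<close>, the
  two sides are given by the sign of \<open>l\<close>. The direction \<open>d\<close> is used to
  approach the point from either side.
\<close>

lemma two_sidedI:
  fixes l :: "complex \<Rightarrow> real"
  assumes A: "open A" "continuous_on A f" "open (f ` A)" "z \<in> A"
    and l: "linear l" "l d = 1" "l z = 0"
    and curve: "\<And>w. w \<in> A \<Longrightarrow> f w \<in> range \<gamma> \<Longrightarrow> l w = 0"
    and curve': "\<And>w. w \<in> A \<Longrightarrow> l w = 0 \<Longrightarrow> f w \<in> range \<gamma>"
    and F: "F \<in> faces K" "\<And>w. w \<in> A \<Longrightarrow> l w > 0 \<Longrightarrow> f w \<in> F"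
    and G: "G \<in> faces K" "\<And>w. w \<in> A \<Longrightarrow> l w < 0 \<Longrightarrow> f w \<in> G"
  shows "two_sided (f z) F G"
proof -
  have "f z \<in> closure {y. \<exists>w. y = f w \<and> w \<in> A \<and> c * l w > 0}" if c: "c \<noteq> 0" for c
  proof (rule tendsto_imp_in_closure)
    have lim: "((\<lambda>r. z + (r * c) *\<^sub>R d) \<longlongrightarrow> z) (at_right 0)" by (auto intro!: tendsto_eq_intros)
    have "isCont f z" using A continuous_on_eq_continuous_at by blast
    then show "((\<lambda>r. f (z + (r * c) *\<^sub>R d)) \<longlongrightarrow> f z) (at_right 0)"
      using lim by (rule isCont_tendsto_compose)
    have "\<forall>\<^sub>F r in at_right 0. z + (r * c) *\<^sub>R d \<in> A" using topological_tendstoD[OF lim A(1,4)] .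
    moreover have "\<forall>\<^sub>F r::real in at_right 0. r > 0" by (rule eventually_at_right_less)
    ultimately show "\<forall>\<^sub>F r in at_right 0. f (z + (r * c) *\<^sub>R d) \<in> {y. \<exists>w. y = f w \<and> w \<in> A \<and> c * l w > 0}"
    proof eventually_elim
      case (elim r)
      have "l (z + (r * c) *\<^sub>R d) = r * c" using l by (simp add: linear_add linear_scale)
      moreover have "c * (r * c) > 0"
        using mult_pos_pos[OF elim(2), of "c * c"] c not_square_less_zero[of c] by (simp add: mult_ac less_le)
      ultimately show ?case using elim by auto
    qed
  qed simp
  from this[of 1] this[of "-1"] have cl: "f z \<in> closure F" "f z \<in> closure G"
    using closure_mono[of "{y. \<exists>w. y = f w \<and> w \<in> A \<and> 1 * l w > 0}" F] F(2)
      closure_mono[of "{y. \<exists>w. y = f w \<and> w \<in> A \<and> - 1 * l w > 0}" G] G(2) by auto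
  have "f w \<in> F \<union> G" if "w \<in> A" "f w \<notin> range \<gamma>" for w
    using that curve' F(2) G(2) by (cases "l w" "0::real" rule: linorder_cases) auto
  then have "f ` A - range \<gamma> \<subseteq> F \<union> G" by auto
  then show ?thesis unfolding two_sided_def using cl F(1) G(1) A(3,4) by blast
qed

lemma not_collinear_i_multiple: assumes "w \<noteq> 0" shows "\<not> collinear {0, w, \<i> * w}"
proof
  assume "collinear {0, w, \<i> * w}"
  then obtain c where "\<i> * w = c *\<^sub>R w" using assms by (auto simp: collinear_lemma)
  then have "\<i> = complex_of_real c" using assms by (simp add: scaleR_conv_of_real)
  then show False by (simp add: complex_eq_iff)
qed

lemma velocity_nonzero: "v t \<noteq> 0"
  using regular unfolding regular_projection_def by blast

lemma regular_point_two_sided: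
  assumes "\<gamma> t \<notin> crossings K"
  obtains \<eta> F G where "\<eta> > 0" "\<And>x. \<bar>x - t\<bar> < \<eta> \<Longrightarrow> two_sided (\<gamma> x) F G"
proof -
  \<comment> \<open>A straight line orthogonal to the curve takes the place of the other strand.\<close>
  define \<delta> where "\<delta> x = \<gamma> t + x *\<^sub>R (\<i> * v t)" for x :: real
  let ?f = "sum_chart \<gamma> \<delta> t 0"
  have \<delta>: "(\<delta> has_vector_derivative \<i> * v t) (at x)" for x
    unfolding \<delta>_def by (auto intro!: derivative_eq_intros)
  have ret: "x - t \<in> \<int> \<or> False \<and> x - 0 \<in> \<int>" if "\<gamma> x = \<gamma> t" for x
    using assms that unfolding crossings_def by blast
  obtain \<eta> where \<eta>: "\<eta> > 0" "continuous_on (square \<eta>) ?f"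
    "\<And>S. open S \<Longrightarrow> S \<subseteq> square \<eta> \<Longrightarrow> open (?f ` S)"
    "\<And>z. z \<in> square \<eta> \<Longrightarrow> ?f z \<in> range \<gamma> \<longleftrightarrow> Im z = 0"
  proof (rule curve_in_transversal_chart[OF \<delta> continuous_on_const _ not_collinear_i_multiple[OF velocity_nonzero] ret])
    show "\<delta> 0 = \<gamma> t" by (simp add: \<delta>_def)
  qed auto
  have "\<exists>F\<in>faces K. ?f ` {z \<in> square \<eta>. b * Im z > 0} \<subseteq> F" if "b \<noteq> 0" for b
  proof (rule connected_in_face)
    show "connected (?f ` {z \<in> square \<eta>. b * Im z > 0})"
      by (intro connected_continuous_image convex_connected convex_half_square
            continuous_on_subset[OF \<eta>(2)]) auto
    have "Complex 0 (sgn b * \<eta> / 2) \<in> {z \<in> square \<eta>. b * Im z > 0}"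
      using that \<eta>(1) by (auto simp: square_def sgn_if mult_neg_pos)
    then show "?f ` {z \<in> square \<eta>. b * Im z > 0} \<noteq> {}" by blast
    have "?f z \<notin> range \<gamma>" if "z \<in> square \<eta>" "b * Im z > 0" for z
      using \<eta>(4)[OF that(1)] that(2) by (cases "Im z = 0") simp_all
    then show "?f ` {z \<in> square \<eta>. b * Im z > 0} \<inter> range \<gamma> = {}" by blast
  qed
  from this[of 1] this[of "-1"] obtain F G where FG: "F \<in> faces K" "G \<in> faces K"
    "?f ` {z \<in> square \<eta>. Im z > 0} \<subseteq> F" "?f ` {z \<in> square \<eta>. Im z < 0} \<subseteq> G" by auto
  show thesis
  proof (rule that[OF \<eta>(1)])
    fix x assume x: "\<bar>x - t\<bar> < \<eta>"
    let ?z = "Complex (x - t) 0"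
    have "two_sided (?f ?z) F G"
    proof (rule two_sidedI[of "square \<eta>" ?f ?z Im \<i>])
      show "linear Im" by (simp add: bounded_linear.linear bounded_linear_Im)
      show "?z \<in> square \<eta>" using x \<eta>(1) by (simp add: square_def)
    show "open (?f ` square \<eta>)" by (rule \<eta>(3)[OF open_square]) simp
      show "?f w \<in> range \<gamma> \<Longrightarrow> Im w = 0" "Im w = 0 \<Longrightarrow> ?f w \<in> range \<gamma>" if "w \<in> square \<eta>" for w
        using \<eta>(4)[OF that] by blast+
      show "?f w \<in> F" if "w \<in> square \<eta>" "0 < Im w" for w using FG(3) that by blast
      show "?f w \<in> G" if "w \<in> square \<eta>" "Im w < 0" for w using FG(4) that by blast
    qed (use \<eta>(2) FG(1,2) open_square in simp_all)
    moreover have "?f ?z = \<gamma> x" by (simp add: sum_chart_def \<delta>_def)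
    ultimately show "two_sided (\<gamma> x) F G" by simp
  qed
qed

lemma over_under_exists:
  assumes "p \<in> crossings K" obtains t s where "over_under K p t s"
proof -
  obtain s t where st: "s - t \<notin> \<int>" "\<gamma> s = p" "\<gamma> t = p" using assms unfolding crossings_def by blast
  then have "K s \<noteq> K t" by (simp add: curve_eq_iff)
  then have "height K s \<noteq> height K t" using st by (auto simp: plane_curve_def height_def prod_eq_iff)
  then show thesis using that[of s t] that[of t s] st by (auto simp: over_under_def neq_iff)
qed

lemma over_under_distinct: "over_under K p t s \<Longrightarrow> s - t \<notin> \<int>"
  using curve_eq_iff by (force simp: over_under_def height_def)

lemma over_under_crossing: "over_under K p t s \<Longrightarrow> p \<in> crossings K"
  using over_under_distinct by (auto simp: crossings_def over_under_def)

text \<open>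
  At most two times modulo the period pass through a point, and the heights tell them apart. So
  the velocities in the definition of \<open>corner\<close> do not depend on the choice of times.
\<close>

lemma over_under_unique:
  assumes "over_under K p t s" "over_under K p t' s'" shows "t' - t \<in> \<int>" "s' - s \<in> \<int>"
proof -
  note d = over_under_distinct[OF assms(1)] over_under_distinct[OF assms(2)]
  have h: "height K x = height K y" if "x - y \<in> \<int>" for x y using that by (metis curve_eq_iff height_def)
  have t: "t' - s \<in> \<int> \<or> t' - t \<in> \<int>" and s: "s' - s \<in> \<int> \<or> s' - t \<in> \<int>"
    using double_point[of s t] d assms by (auto simp: over_under_def)
  have ht: "height K s < height K t" "height K s' < height K t'" using assms by (auto simp: over_under_def)
  have sub: "x - z \<in> \<int>" if "x - y \<in> \<int>" "z - y \<in> \<int>" for x y z :: real using Ints_diff[OF that] by simp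
  show "t' - t \<in> \<int>" using t s ht h d(2) sub[of s' s t'] by fastforce
  show "s' - s \<in> \<int>" using t s ht h d(2) sub[of s' t t'] by fastforce
qed

text \<open>
  The image of an open quadrant of the chart is connected and avoids the curve, so it lies in one
  face. The ray in the definition of \<open>corner\<close> eventually runs in that image, hence
  this face is the corner.
\<close>

lemma crossing_sectors:
  assumes ou: "over_under K p t s"
  obtains \<eta> f where "\<eta> > 0" "open (f ` square \<eta>)" "f 0 = p" "continuous_on (square \<eta>) f"
    "\<And>S. open S \<Longrightarrow> S \<subseteq> square \<eta> \<Longrightarrow> open (f ` S)"
    "\<And>x. f (Complex x 0) = \<gamma> (t + x)" "\<And>x. f (Complex 0 x) = \<gamma> (s + x)"
    "\<And>z. z \<in> square \<eta> \<Longrightarrow> f z \<in> range \<gamma> \<longleftrightarrow> Im z = 0 \<or> Re z = 0"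
    "\<And>a b. a \<in> {1,-1} \<Longrightarrow> b \<in> {1,-1} \<Longrightarrow> corner K p a b \<in> faces K"
    "\<And>a b z. a \<in> {1,-1} \<Longrightarrow> b \<in> {1,-1} \<Longrightarrow> z \<in> square \<eta> \<Longrightarrow> a * Re z > 0 \<Longrightarrow> b * Im z > 0
       \<Longrightarrow> f z \<in> corner K p a b"
proof -
  let ?f = "sum_chart \<gamma> \<gamma> t s"
  have p: "\<gamma> t = p" "\<gamma> s = p" using ou by (auto simp: over_under_def)
  have nst: "s - t \<notin> \<int>" using ou by (rule over_under_distinct)
  then have nts: "t - s \<notin> \<int>" by (metis Ints_minus minus_diff_eq)
  have tr: "\<not> collinear {0, v t, v s}"
    using regular nts p unfolding regular_projection_def by metis
  have ret: "x - t \<in> \<int> \<or> True \<and> x - s \<in> \<int>" if "\<gamma> x = \<gamma> t" for x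
    using double_point[OF _ nst that] p by auto
  obtain \<eta> where \<eta>: "\<eta> > 0" "continuous_on (square \<eta>) ?f"
    "\<And>S. open S \<Longrightarrow> S \<subseteq> square \<eta> \<Longrightarrow> open (?f ` S)"
    "\<And>z. z \<in> square \<eta> \<Longrightarrow> ?f z \<in> range \<gamma> \<longleftrightarrow> Im z = 0 \<or> Re z = 0"
    "\<And>a b. a \<noteq> 0 \<Longrightarrow> b \<noteq> 0 \<Longrightarrow> \<forall>\<^sub>F r in at_right 0. \<gamma> t + r *\<^sub>R (a *\<^sub>R v t + b *\<^sub>R v s)
        \<in> ?f ` {z \<in> square \<eta>. a * Re z > 0 \<and> b * Im z > 0}"
  proof (rule curve_in_transversal_chart[OF has_velocity continuous_velocity _ tr ret])
    show "\<gamma> s = \<gamma> t" using p by simp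
    show "\<gamma> = \<gamma>" by (rule refl)
  qed simp_all
  have corner: "corner K p a b \<in> faces K \<and> ?f ` {z \<in> square \<eta>. a * Re z > 0 \<and> b * Im z > 0} \<subseteq> corner K p a b"
    if ab: "a \<in> {1,-1}" "b \<in> {1,-1}" for a b
  proof -
    let ?Q = "?f ` {z \<in> square \<eta>. a * Re z > 0 \<and> b * Im z > 0}"
    have nz: "a \<noteq> 0" "b \<noteq> 0" using ab by auto
    have ray: "\<forall>\<^sub>F r in at_right 0. p + r *\<^sub>R (a *\<^sub>R v t + b *\<^sub>R v s) \<in> ?Q"
      using \<eta>(5)[OF nz] p by simp
    have "\<exists>F\<in>faces K. ?Q \<subseteq> F"
    proof (rule connected_in_face)
      show "connected ?Q"
        by (intro connected_continuous_image convex_connected convex_sector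
              continuous_on_subset[OF \<eta>(2)]) auto
      show "?Q \<noteq> {}" using eventually_happens[OF ray] by auto
      have "?f z \<notin> range \<gamma>" if "z \<in> square \<eta>" "a * Re z > 0" "b * Im z > 0" for z
        using \<eta>(4)[OF that(1)] that(2,3) by (cases "Im z = 0"; cases "Re z = 0") simp_all
      then show "?Q \<inter> range \<gamma> = {}" by blast
    qed
    then obtain F where F: "F \<in> faces K" "?Q \<subseteq> F" by blast
    have "corner K p a b = F"
      unfolding corner_def
    proof (rule the_equality)
      show "F \<in> faces K \<and> (\<exists>t s. over_under K p t s \<and>
         (\<forall>\<^sub>F r in at_right 0. p + r *\<^sub>R (a *\<^sub>R v t + b *\<^sub>R v s) \<in> F))"
      proof (intro conjI exI)
        show "\<forall>\<^sub>F r in at_right 0. p + r *\<^sub>R (a *\<^sub>R v t + b *\<^sub>R v s) \<in> F"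
          using ray by eventually_elim (rule subsetD[OF F(2)])
      qed (use F(1) ou in simp_all)
      fix G assume "G \<in> faces K \<and> (\<exists>t s. over_under K p t s \<and>
         (\<forall>\<^sub>F r in at_right 0. p + r *\<^sub>R (a *\<^sub>R v t + b *\<^sub>R v s) \<in> G))"
      then obtain t' s' where G: "G \<in> faces K" "over_under K p t' s'"
        "\<forall>\<^sub>F r in at_right 0. p + r *\<^sub>R (a *\<^sub>R v t' + b *\<^sub>R v s') \<in> G" by blast
      have "v t' = v t" "v s' = v s"
        using over_under_unique[OF ou G(2)] velocity_periodic by auto
      with G(3) have "\<forall>\<^sub>F r in at_right 0. p + r *\<^sub>R (a *\<^sub>R v t + b *\<^sub>R v s) \<in> G" by simp
      then have "\<forall>\<^sub>F r::real in at_right 0. \<exists>z. z \<in> G \<and> z \<in> F"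
        using ray by eventually_elim (use F in blast)
      then obtain z where "z \<in> G" "z \<in> F" using eventually_happens by force
      then show "G = F" using face_eqI[OF G(1) F(1)] by blast
    qed
    then show ?thesis using F by simp
  qed
  show thesis
  proof (rule that[OF \<eta>(1) _ _ \<eta>(2,3)])
    show "open (?f ` square \<eta>)" by (rule \<eta>(3)[OF open_square]) simp
    show "?f z \<in> range \<gamma> \<longleftrightarrow> Im z = 0 \<or> Re z = 0" if "z \<in> square \<eta>" for z using \<eta>(4)[OF that] .
    show "corner K p a b \<in> faces K" if "a \<in> {1,-1}" "b \<in> {1,-1}" for a b using corner[OF that] by blast
    show "?f z \<in> corner K p a b"
      if "a \<in> {1,-1}" "b \<in> {1,-1}" "z \<in> square \<eta>" "a * Re z > 0" "b * Im z > 0" for a b z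
      using corner[OF that(1,2)] that(3-) by blast
  qed (use p in \<open>simp_all add: sum_chart_def\<close>)
qed

lemma corner_face: "p \<in> crossings K \<Longrightarrow> a \<in> {1,-1} \<Longrightarrow> b \<in> {1,-1} \<Longrightarrow> corner K p a b \<in> faces K"
  using over_under_exists crossing_sectors by metis

text \<open>
  Every point of the chart off the axes lies in one of the four quadrants, so no further face
  comes close to \<open>p\<close>. This identifies the edges of the graph with the terms of the
  Dehn relations.
\<close>

lemma incident_iff_corner:
  assumes p: "p \<in> crossings K" and F: "F \<in> faces K"
  shows "p \<in> frontier F \<longleftrightarrow> (\<exists>a\<in>{1,-1}. \<exists>b\<in>{1,-1}. F = corner K p a b)"
proof -
  obtain t s where ou: "over_under K p t s" using over_under_exists[OF p] .
  obtain \<eta> f where m: "\<eta> > 0" "open (f ` square \<eta>)" "f 0 = p" "continuous_on (square \<eta>) f"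
    "\<And>z. z \<in> square \<eta> \<Longrightarrow> f z \<in> range \<gamma> \<longleftrightarrow> Im z = 0 \<or> Re z = 0"
    "\<And>a b z. a \<in> {1,-1} \<Longrightarrow> b \<in> {1,-1} \<Longrightarrow> z \<in> square \<eta> \<Longrightarrow> a * Re z > 0 \<Longrightarrow> b * Im z > 0
       \<Longrightarrow> f z \<in> corner K p a b"
    by (rule crossing_sectors[OF ou], rule that)
  have 0: "0 \<in> square \<eta>" using m(1) by (simp add: square_def)
  have "p \<in> range \<gamma>" using ou by (auto simp: over_under_def)
  then have "p \<notin> F" using face_off_curve[OF F] by blast
  then have fr: "p \<in> frontier F \<longleftrightarrow> p \<in> closure F"
    using face_open[OF F] by (simp add: frontier_def interior_open)
  show ?thesis unfolding fr
  proof
    assume "p \<in> closure F"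
    then obtain z where z: "z \<in> square \<eta>" "f z \<in> F"
      using m(2,3) 0 closure_iff_nhds_not_empty[of p F] by blast
    have nz: "Im z \<noteq> 0" "Re z \<noteq> 0" using m(5)[OF z(1)] face_off_curve[OF F z(2)] by auto
    have "f z \<in> corner K p (sgn (Re z)) (sgn (Im z))"
      by (rule m(6)) (use nz z in \<open>auto simp: sgn_if\<close>)
    moreover have "sgn (Re z) \<in> {1,-1}" "sgn (Im z) \<in> {1,-1}" using nz by (auto simp: sgn_if)
    ultimately show "\<exists>a\<in>{1,-1}. \<exists>b\<in>{1,-1}. F = corner K p a b"
      using face_eqI[OF F _ z(2)] corner_face[OF p] by blast
  next
    assume "\<exists>a\<in>{1,-1}. \<exists>b\<in>{1,-1}. F = corner K p a b"
    then obtain a b :: real where ab: "a \<in> {1,-1}" "b \<in> {1,-1}" "F = corner K p a b" by blast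
    have lim: "((\<lambda>r. Complex (r * a) (r * b)) \<longlongrightarrow> 0) (at_right 0)"
      by (auto intro!: tendsto_eq_intros simp: tendsto_complex_iff)
    show "p \<in> closure F"
    proof (rule tendsto_imp_in_closure)
      have "isCont f 0" using m(4) open_square 0 continuous_on_eq_continuous_at by blast
      from isCont_tendsto_compose[OF this lim] m(3)
      show "((\<lambda>r. f (Complex (r * a) (r * b))) \<longlongrightarrow> p) (at_right 0)" by simp
      have "\<forall>\<^sub>F r in at_right 0. Complex (r * a) (r * b) \<in> square \<eta>"
        using topological_tendstoD[OF lim open_square 0] .
      moreover have "\<forall>\<^sub>F r::real in at_right 0. r > 0" by (rule eventually_at_right_less)
      ultimately show "\<forall>\<^sub>F r in at_right 0. f (Complex (r * a) (r * b)) \<in> F"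
      proof eventually_elim
        case (elim r)
        then show ?case unfolding ab(3) by (intro m(6)) (use ab in auto)
      qed
    qed simp
  qed
qed

text \<open>
  Just before (\<open>a = -1\<close>) or after (\<open>a = 1\<close>) the crossing, the over
  strand separates the corners that differ in the direction along the under strand, and vice
  versa.
\<close>

lemma strands_two_sided:
  assumes ou: "over_under K p t s"
  obtains \<eta> where "\<eta> > 0"
    "\<And>a x. a \<in> {1,-1} \<Longrightarrow> 0 < a * (x - t) \<Longrightarrow> a * (x - t) < \<eta> \<Longrightarrow>
        two_sided (\<gamma> x) (corner K p a 1) (corner K p a (-1))"
    "\<And>b x. b \<in> {1,-1} \<Longrightarrow> 0 < b * (x - s) \<Longrightarrow> b * (x - s) < \<eta> \<Longrightarrow>
        two_sided (\<gamma> x) (corner K p 1 b) (corner K p (-1) b)"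
proof -
  obtain \<eta> f where m: "\<eta> > 0" "continuous_on (square \<eta>) f"
    "\<And>S. open S \<Longrightarrow> S \<subseteq> square \<eta> \<Longrightarrow> open (f ` S)"
    "\<And>x. f (Complex x 0) = \<gamma> (t + x)" "\<And>x. f (Complex 0 x) = \<gamma> (s + x)"
    "\<And>z. z \<in> square \<eta> \<Longrightarrow> f z \<in> range \<gamma> \<longleftrightarrow> Im z = 0 \<or> Re z = 0"
    "\<And>a b z. a \<in> {1,-1} \<Longrightarrow> b \<in> {1,-1} \<Longrightarrow> z \<in> square \<eta> \<Longrightarrow> a * Re z > 0 \<Longrightarrow> b * Im z > 0
       \<Longrightarrow> f z \<in> corner K p a b"
    by (rule crossing_sectors[OF ou], rule that)
  note cf = corner_face[OF over_under_crossing[OF ou]]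
  show thesis
  proof (rule that[OF m(1)])
    fix a x :: real assume a: "a \<in> {1,-1}" and x: "0 < a * (x - t)" "a * (x - t) < \<eta>"
    let ?A = "{z \<in> square \<eta>. a * Re z > 0}" and ?z = "Complex (x - t) 0"
    have o: "open ?A"
      using open_Int[OF open_square[of \<eta>] open_Collect_less[of "\<lambda>_. 0" "\<lambda>z. a * Re z"]]
      by (simp add: Int_def continuous_on_mult continuous_on_Re continuous_on_Im)
    have "two_sided (f ?z) (corner K p a 1) (corner K p a (-1))"
    proof (rule two_sidedI[of ?A f ?z Im \<i>])
      show "continuous_on ?A f" using m(2) by (rule continuous_on_subset) auto
      show "linear Im" by (simp add: bounded_linear.linear bounded_linear_Im)
      show "?z \<in> ?A" using x m(1) a by (auto simp: square_def)
      show "f w \<in> corner K p a 1" if "w \<in> ?A" "Im w > 0" for w using that m(7)[OF a] by auto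
      show "f w \<in> corner K p a (-1)" if "w \<in> ?A" "Im w < 0" for w using that m(7)[OF a] by auto
      show "open ?A" by (rule o)
      show "open (f ` ?A)" using o by (rule m(3)) auto
      show "Im w = 0" if "w \<in> ?A" "f w \<in> range \<gamma>" for w using m(6)[of w] that by auto
      show "f w \<in> range \<gamma>" if "w \<in> ?A" "Im w = 0" for w using m(6)[of w] that by blast
    qed (use a cf in simp_all)
    then show "two_sided (\<gamma> x) (corner K p a 1) (corner K p a (-1))" by (simp add: m(4))
  next
    fix b x :: real assume b: "b \<in> {1,-1}" and x: "0 < b * (x - s)" "b * (x - s) < \<eta>"
    let ?A = "{z \<in> square \<eta>. b * Im z > 0}" and ?z = "Complex 0 (x - s)"
    have o: "open ?A"
      using open_Int[OF open_square[of \<eta>] open_Collect_less[of "\<lambda>_. 0" "\<lambda>z. b * Im z"]]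
      by (simp add: Int_def continuous_on_mult continuous_on_Re continuous_on_Im)
    have "two_sided (f ?z) (corner K p 1 b) (corner K p (-1) b)"
    proof (rule two_sidedI[of ?A f ?z Re 1])
      show "continuous_on ?A f" using m(2) by (rule continuous_on_subset) auto
      show "linear Re" by (simp add: bounded_linear.linear bounded_linear_Re)
      show "?z \<in> ?A" using x m(1) b by (auto simp: square_def)
      show "f w \<in> corner K p 1 b" if "w \<in> ?A" "Re w > 0" for w using that m(7)[OF _ b] by auto
      show "f w \<in> corner K p (-1) b" if "w \<in> ?A" "Re w < 0" for w using that m(7)[OF _ b] by auto
      show "open ?A" by (rule o)
      show "open (f ` ?A)" using o by (rule m(3)) auto
      show "Re w = 0" if "w \<in> ?A" "f w \<in> range \<gamma>" for w using m(6)[of w] that by auto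
      show "f w \<in> range \<gamma>" if "w \<in> ?A" "Re w = 0" for w using m(6)[of w] that by blast
    qed (use b cf in simp_all)
    then show "two_sided (\<gamma> x) (corner K p 1 b) (corner K p (-1) b)" by (simp add: m(5))
  qed
qed

end

section \<open>Colorings that are balanced at every crossing\<close>

context knot_diagram
begin

text \<open>
  The consequences of the Dehn relation modulo \<open>2\<close> that involve only equality of
  labels: the two faces along a strand agree before the crossing if and only if they agree after
  it, for the over strand as well as for the under strand.
\<close>

definition balanced :: "(complex set \<Rightarrow> 'c) \<Rightarrow> bool" where
  "balanced X \<longleftrightarrow> (\<forall>p\<in>crossings K.
     (X (corner K p 1 1) = X (corner K p 1 (-1)) \<longleftrightarrow> X (corner K p (-1) 1) = X (corner K p (-1) (-1))) \<and>
     (X (corner K p 1 1) = X (corner K p (-1) 1) \<longleftrightarrow> X (corner K p 1 (-1)) = X (corner K p (-1) (-1))))"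

definition unicolored :: "(complex set \<Rightarrow> 'c) \<Rightarrow> complex \<Rightarrow> bool" where
  "unicolored X q \<longleftrightarrow> (\<exists>F G. two_sided q F G \<and> X F = X G)"

lemma unicolored_iff: assumes "two_sided q F G" shows "unicolored X q \<longleftrightarrow> X F = X G"
proof
  assume "unicolored X q"
  then obtain F' G' where "two_sided q F' G'" "X F' = X G'" unfolding unicolored_def by blast
  then show "X F = X G" using two_sided_unique[OF assms] by (metis doubleton_eq_iff)
qed (use assms in \<open>auto simp: unicolored_def\<close>)

text \<open>
  Countability is used to find regular times in every interval.
\<close>

lemma countable_crossing_times: "countable {t. \<gamma> t \<in> crossings K}"
proof -
  have "countable {t. \<gamma> t = p}" if p: "p \<in> crossings K" for p
  proof -
    obtain t s where ou: "over_under K p t s" using over_under_exists[OF p] .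
    have "x - s \<in> \<int> \<or> x - t \<in> \<int>" if "\<gamma> x = p" for x
      using double_point[OF _ over_under_distinct[OF ou]] ou that by (auto simp: over_under_def)
    then have "{t. \<gamma> t = p} \<subseteq> (\<lambda>y. y + s) ` \<int> \<union> (\<lambda>y. y + t) ` \<int>"
      by (force simp: image_iff)
    moreover have "countable (\<int> :: real set)" by (simp add: Ints_def)
    ultimately show ?thesis by (meson countable_Un countable_image countable_subset)
  qed
  moreover have "{t. \<gamma> t \<in> crossings K} = (\<Union>p\<in>crossings K. {t. \<gamma> t = p})" by auto
  moreover have "finite (crossings K)" using regular by (simp add: regular_projection_def)
  ultimately show ?thesis by (auto intro: countable_finite)
qed

lemma regular_time_exists:
  assumes "open T" "T \<noteq> {}" obtains t where "t \<in> T" "\<gamma> t \<notin> crossings K"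
proof -
  obtain t where "t \<in> T" "t \<notin> {t. \<gamma> t \<in> crossings K}"
    using open_minus_countable[OF countable_crossing_times assms(2,1)] by blast
  then show thesis using that by blast
qed

text \<open>
  By periodicity the time \<open>a\<close> may be replaced by the time \<open>t\<close> of the
  over strand or \<open>s\<close> of the under strand, and balance compares the corners just
  before with those just after the crossing.
\<close>

lemma unicolored_near_crossing:
  assumes X: "balanced X" and a: "\<gamma> a \<in> crossings K"
  obtains \<eta> c where "\<eta> > 0" "\<And>x. \<bar>x - a\<bar> < \<eta> \<Longrightarrow> x \<noteq> a \<Longrightarrow> unicolored X (\<gamma> x) = c"
proof -
  define p where "p = \<gamma> a"
  obtain t s where ou: "over_under K p t s" using over_under_exists a p_def by metis
  obtain \<eta> where \<eta>: "\<eta> > 0"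
    "\<And>a x. a \<in> {1,-1} \<Longrightarrow> 0 < a * (x - t) \<Longrightarrow> a * (x - t) < \<eta> \<Longrightarrow>
        two_sided (\<gamma> x) (corner K p a 1) (corner K p a (-1))"
    "\<And>b x. b \<in> {1,-1} \<Longrightarrow> 0 < b * (x - s) \<Longrightarrow> b * (x - s) < \<eta> \<Longrightarrow>
        two_sided (\<gamma> x) (corner K p 1 b) (corner K p (-1) b)"
    by (rule strands_two_sided[OF ou], rule that)
  have bal: "X (corner K p 1 1) = X (corner K p 1 (-1)) \<longleftrightarrow> X (corner K p (-1) 1) = X (corner K p (-1) (-1))"
    "X (corner K p 1 1) = X (corner K p (-1) 1) \<longleftrightarrow> X (corner K p 1 (-1)) = X (corner K p (-1) (-1))"
    using X a unfolding balanced_def p_def by blast+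
  have sg: "sgn y \<in> {1, -1}" "0 < sgn y * y" "sgn y * y = \<bar>y\<bar>" if "y \<noteq> 0" for y :: real
    using that by (auto simp: sgn_if)
  have "a - s \<in> \<int> \<or> a - t \<in> \<int>"
    using double_point[OF _ over_under_distinct[OF ou]] ou p_def by (auto simp: over_under_def)
  then show thesis
  proof
    assume at: "a - t \<in> \<int>"
    show thesis
    proof (rule that[OF \<eta>(1), of "X (corner K p 1 1) = X (corner K p 1 (-1))"])
      fix x assume x: "\<bar>x - a\<bar> < \<eta>" "x \<noteq> a"
      let ?x = "x - a + t"
      have "\<gamma> x = \<gamma> ?x" using at by (intro curve_periodic) simp
      moreover have "two_sided (\<gamma> ?x) (corner K p (sgn (x - a)) 1) (corner K p (sgn (x - a)) (-1))"
        by (rule \<eta>(2)) (use sg[of "x - a"] x in auto)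
      ultimately show "unicolored X (\<gamma> x) = (X (corner K p 1 1) = X (corner K p 1 (-1)))"
        using unicolored_iff[of "\<gamma> x" _ _ X] sg(1)[of "x - a"] x bal by auto
    qed
  next
    assume at: "a - s \<in> \<int>"
    show thesis
    proof (rule that[OF \<eta>(1), of "X (corner K p 1 1) = X (corner K p (-1) 1)"])
      fix x assume x: "\<bar>x - a\<bar> < \<eta>" "x \<noteq> a"
      let ?x = "x - a + s"
      have "\<gamma> x = \<gamma> ?x" using at by (intro curve_periodic) simp
      moreover have "two_sided (\<gamma> ?x) (corner K p 1 (sgn (x - a))) (corner K p (-1) (sgn (x - a)))"
        by (rule \<eta>(3)) (use sg[of "x - a"] x in auto)
      ultimately show "unicolored X (\<gamma> x) = (X (corner K p 1 1) = X (corner K p (-1) 1))"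
        using unicolored_iff[of "\<gamma> x" _ _ X] sg(1)[of "x - a"] x bal by auto
    qed
  qed
qed

text \<open>
  Whether the two sides have the same label is locally constant in time, also across the times of
  crossings, and the real line is connected.
\<close>

lemma unicolored_everywhere:
  assumes X: "balanced X" and "\<gamma> t \<notin> crossings K" "\<gamma> t' \<notin> crossings K" "unicolored X (\<gamma> t)"
  shows "unicolored X (\<gamma> t')"
proof (rule connected_induction[of UNIV "\<lambda>t. \<gamma> t \<notin> crossings K" "\<lambda>t. unicolored X (\<gamma> t)" t t'])
  fix T :: "real set" and a assume "openin (top_of_set UNIV) T" "a \<in> T"
  then have "open T" "T \<noteq> {}" by auto
  then show "\<exists>z. z \<in> T \<and> \<gamma> z \<notin> crossings K" using regular_time_exists by blast
next
  fix a :: real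
  have "\<exists>\<eta>>0. \<exists>c. \<forall>x. \<bar>x - a\<bar> < \<eta> \<and> \<gamma> x \<notin> crossings K \<longrightarrow> unicolored X (\<gamma> x) = c"
  proof (cases "\<gamma> a \<in> crossings K")
    case True
    then obtain \<eta> c where "\<eta> > 0" "\<And>x. \<bar>x - a\<bar> < \<eta> \<Longrightarrow> x \<noteq> a \<Longrightarrow> unicolored X (\<gamma> x) = c"
      using unicolored_near_crossing[OF X] by blast
    with True show ?thesis by (intro exI[of _ \<eta>] conjI exI[of _ c] allI impI) auto
  next
    case False
    then obtain \<eta> F G where "\<eta> > 0" and sides: "\<And>x. \<bar>x - a\<bar> < \<eta> \<Longrightarrow> two_sided (\<gamma> x) F G"
      using regular_point_two_sided by blast
    have "\<And>x. \<bar>x - a\<bar> < \<eta> \<Longrightarrow> unicolored X (\<gamma> x) = (X F = X G)"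
      by (rule unicolored_iff[OF sides])
    with \<open>\<eta> > 0\<close> show ?thesis by (intro exI[of _ \<eta>] conjI exI[of _ "X F = X G"] allI impI) auto
  qed
  then obtain \<eta> c where "\<eta> > 0"
    "\<forall>x. \<bar>x - a\<bar> < \<eta> \<and> \<gamma> x \<notin> crossings K \<longrightarrow> unicolored X (\<gamma> x) = c"
    by (elim exE conjE) (rule that)
  then show "\<exists>T. openin (top_of_set UNIV) T \<and> a \<in> T \<and> (\<forall>x\<in>T. \<forall>y\<in>T.
      \<gamma> x \<notin> crossings K \<and> \<gamma> y \<notin> crossings K \<and> unicolored X (\<gamma> x) \<longrightarrow> unicolored X (\<gamma> y))"
    by (intro exI[of _ "ball a \<eta>"] conjI ballI impI)
       (simp_all add: dist_real_def abs_minus_commute, metis)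
qed (use assms in simp_all)

lemma face_at: "z \<notin> range \<gamma> \<Longrightarrow> \<exists>F\<in>faces K. z \<in> F"
  using connected_in_face[of "{z}"] by auto

text \<open>
  The plane without the crossings is connected, and on it the label is locally constant: at
  regular points of the curve the two sides agree.
\<close>

lemma unicolored_imp_constant:
  assumes X: "\<And>t. \<gamma> t \<notin> crossings K \<Longrightarrow> unicolored X (\<gamma> t)" and FG: "F \<in> faces K" "G \<in> faces K"
  shows "X F = X G"
proof -
  have fin: "finite (crossings K)" using regular by (simp add: regular_projection_def)
  define S where "S = - crossings K"
  have S: "open S" "connected S"
    unfolding S_def using fin connected_open_diff_countable[of "UNIV :: complex set" "crossings K"]
    by (auto simp: Compl_eq_Diff_UNIV finite_imp_closed open_Diff countable_finite)
  obtain z w where z: "z \<in> F" "w \<in> G" using face_nonempty FG by blast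
  have off: "z \<notin> range \<gamma>" "w \<notin> range \<gamma>" using z FG face_off_curve by auto
  have inS: "x \<in> S" if "x \<notin> range \<gamma>" for x using that unfolding S_def crossings_def by auto
  have local: "\<exists>N. open N \<and> q \<in> N \<and> N - range \<gamma> \<noteq> {} \<and> (\<exists>c. \<forall>H\<in>faces K. H \<inter> N \<noteq> {} \<longrightarrow> X H = c)"
    if q: "q \<in> S" for q
  proof (cases "q \<in> range \<gamma>")
    case True
    then obtain t where t: "q = \<gamma> t" "\<gamma> t \<notin> crossings K" using q S_def by auto
    obtain A B where AB: "two_sided q A B" "X A = X B" using X[OF t(2)] t(1) unfolding unicolored_def by blast
    then obtain N where N: "open N" "q \<in> N" "N - range \<gamma> \<subseteq> A \<union> B" and AB': "A \<in> faces K" "B \<in> faces K" "q \<in> closure A"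
      unfolding two_sided_def by blast
    have "X H = X A" if H: "H \<in> faces K" "H \<inter> N \<noteq> {}" for H
    proof -
      obtain y where y: "y \<in> H" "y \<in> N" using H(2) by blast
      then have "y \<in> A \<or> y \<in> B" using N(3) face_off_curve[OF H(1) y(1)] by blast
      then have "H = A \<or> H = B" using face_eqI[OF H(1) _ y(1)] AB' by blast
      then show ?thesis using AB(2) by auto
    qed
    moreover obtain y where "y \<in> N" "y \<in> A"
      using N(1,2) AB'(3) closure_iff_nhds_not_empty[of q A] by blast
    then have "N - range \<gamma> \<noteq> {}" using face_off_curve[OF AB'(1)] by blast
    ultimately show ?thesis using N(1,2) by (intro exI[of _ N]) auto
  next
    case False
    then obtain H where H: "H \<in> faces K" "q \<in> H" using face_at by blast
    have "X H' = X H" if "H' \<in> faces K" "H' \<inter> H \<noteq> {}" for H' using face_eqI[OF that(1) H(1)] that by blast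
    then show ?thesis using H face_open[OF H(1)] False by (intro exI[of _ H]) auto
  qed
  have "\<forall>H\<in>faces K. w \<in> H \<longrightarrow> X H = X F"
  proof (rule connected_induction[of S "\<lambda>x. x \<notin> range \<gamma>" "\<lambda>x. \<forall>H\<in>faces K. x \<in> H \<longrightarrow> X H = X F" z w])
    fix T a assume T: "openin (top_of_set S) T" "a \<in> T"
    then have T': "open T" "a \<in> S" using S(1) openin_open_eq by blast+
    show "\<exists>z. z \<in> T \<and> z \<notin> range \<gamma>"
    proof (cases "a \<in> range \<gamma>")
      case True
      then obtain t where t: "a = \<gamma> t" "\<gamma> t \<notin> crossings K" using T' S_def by auto
      then obtain A where "A \<in> faces K" "a \<in> closure A"
        using X unfolding unicolored_def two_sided_def by blast
      moreover from this obtain y where "y \<in> T" "y \<in> A"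
        using T(2) T'(1) closure_iff_nhds_not_empty[of a A] by blast
      ultimately show ?thesis using face_off_curve by blast
    qed (use T in blast)
  next
    fix a assume "a \<in> S"
    from local[OF this] obtain N c where N: "open N" "a \<in> N" "\<forall>H\<in>faces K. H \<inter> N \<noteq> {} \<longrightarrow> X H = c"
      by (elim exE conjE) (rule that)
    have "\<forall>x\<in>N \<inter> S. \<forall>y\<in>N \<inter> S. x \<notin> range \<gamma> \<and> y \<notin> range \<gamma> \<and> (\<forall>H\<in>faces K. x \<in> H \<longrightarrow> X H = X F)
         \<longrightarrow> (\<forall>H\<in>faces K. y \<in> H \<longrightarrow> X H = X F)"
    proof (intro ballI impI, elim conjE)
      fix x y H assume x: "x \<in> N \<inter> S" "x \<notin> range \<gamma>" "\<forall>H\<in>faces K. x \<in> H \<longrightarrow> X H = X F"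
        and y: "y \<in> N \<inter> S" "H \<in> faces K" "y \<in> H"
      obtain H' where H': "H' \<in> faces K" "x \<in> H'" using face_at x(2) by blast
      have "X H' = c" using N(3) H' x(1) by blast
      moreover have "X H' = X F" using x(3) H' by blast
      moreover have "X H = c" using N(3) y by blast
      ultimately show "X H = X F" by simp
    qed
    moreover have "openin (top_of_set S) (N \<inter> S)" "a \<in> N \<inter> S"
      using N(1,2) \<open>a \<in> S\<close> openin_open_Int[of N S] by (simp_all add: Int_commute)
    ultimately show "\<exists>T. openin (top_of_set S) T \<and> a \<in> T \<and> (\<forall>x\<in>T. \<forall>y\<in>T. x \<notin> range \<gamma> \<and> y \<notin> range \<gamma> \<and>
         (\<forall>H\<in>faces K. x \<in> H \<longrightarrow> X H = X F) \<longrightarrow> (\<forall>H\<in>faces K. y \<in> H \<longrightarrow> X H = X F))"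
      by (intro exI[of _ "N \<inter> S"] conjI)
  next
    show "\<forall>H\<in>faces K. z \<in> H \<longrightarrow> X H = X F"
    proof (intro ballI impI)
      fix H assume "H \<in> faces K" "z \<in> H"
      then show "X H = X F" using face_eqI[OF FG(1) _ z(1)] by metis
    qed
  qed (use S inS off in simp_all)
  then show ?thesis using FG(2) z(2) by metis
qed

text \<open>
  The common boundary contains a whole piece of the curve, hence a regular point, and the two
  faces there can only be the given ones.
\<close>

lemma adjacent_faces_two_sided:
  assumes "adjacent_faces K F G"
  obtains t where "\<gamma> t \<notin> crossings K" "two_sided (\<gamma> t) F G"
proof -
  obtain a b where FG: "F \<in> faces K" "G \<in> faces K" "F \<noteq> G"
    and ab: "a < b" "\<gamma> ` {a<..<b} \<subseteq> frontier F \<inter> frontier G"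
    using assms unfolding adjacent_faces_def by blast
  obtain t where t: "t \<in> {a<..<b}" "\<gamma> t \<notin> crossings K"
    by (rule regular_time_exists[of "{a<..<b}"]) (use ab(1) in auto)
  obtain A B where AB: "two_sided (\<gamma> t) A B"
    using regular_point_two_sided[OF t(2)] by (metis abs_zero cancel_comm_monoid_add_class.diff_cancel)
  have "\<gamma> t \<in> closure F" "\<gamma> t \<in> closure G" 
    using subsetD[OF ab(2) imageI[OF t(1)]] by (simp_all add: frontier_def)
  then have "F = A \<or> F = B" "G = A \<or> G = B" using two_sided_face[OF AB] FG by blast+
  then have "two_sided (\<gamma> t) F G" using AB FG(3) unfolding two_sided_def by (auto simp: Un_commute)
  then show thesis using that t(2) by blast
qed

lemma unbounded_face_unique:
  "U \<in> faces K \<Longrightarrow> U' \<in> faces K \<Longrightarrow> \<not> bounded U \<Longrightarrow> \<not> bounded U' \<Longrightarrow> U = U'"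
  unfolding faces_def
  using cobounded_unique_unbounded_components[of "- range \<gamma>"] compact_range compact_imp_bounded by auto

lemma balanced_constant:
  assumes "balanced X" "adjacent_faces K F G" "X F = X G" "A \<in> faces K" "B \<in> faces K"
  shows "X A = X B"
proof -
  obtain t where t: "\<gamma> t \<notin> crossings K" "two_sided (\<gamma> t) F G" using adjacent_faces_two_sided assms(2) .
  then have "unicolored X (\<gamma> t)" using unicolored_iff assms(3) by blast
  then show ?thesis using unicolored_imp_constant assms(4,5) unicolored_everywhere[OF assms(1) t(1)] by blast
qed

text \<open>
  If the labels agreed across one piece of the curve, they would agree everywhere.
\<close>

lemma balanced_checkerboard:
  assumes X: "balanced X" and FG: "adjacent_faces K F G" "X F \<noteq> X G"
  shows "adjacent_faces K A B \<Longrightarrow> X A \<noteq> X B"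
    and "p \<in> crossings K \<Longrightarrow> a \<in> {1,-1} \<Longrightarrow> X (corner K p a 1) \<noteq> X (corner K p a (-1))"
proof -
  show "X A \<noteq> X B" if "adjacent_faces K A B"
    using balanced_constant[OF X that] FG unfolding adjacent_faces_def by blast
  show "X (corner K p a 1) \<noteq> X (corner K p a (-1))" if p: "p \<in> crossings K" and a: "a \<in> {1,-1}" for a
  proof
    assume eq: "X (corner K p a 1) = X (corner K p a (-1))"
    obtain t s where ou: "over_under K p t s" using over_under_exists[OF p] .
    obtain \<eta> where \<eta>: "\<eta> > 0" "\<And>x. 0 < a * (x - t) \<Longrightarrow> a * (x - t) < \<eta> \<Longrightarrow>
        two_sided (\<gamma> x) (corner K p a 1) (corner K p a (-1))"
      using strands_two_sided[OF ou] a by metis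
    have "open {x. 0 < a * (x - t) \<and> a * (x - t) < \<eta>}"
      by (intro open_Collect_conj open_Collect_less continuous_intros)
    moreover have "t + a * \<eta> / 2 \<in> {x. 0 < a * (x - t) \<and> a * (x - t) < \<eta>}" using a \<eta>(1) by auto
    ultimately obtain x where x: "0 < a * (x - t)" "a * (x - t) < \<eta>" "\<gamma> x \<notin> crossings K"
      using regular_time_exists[of "{x. 0 < a * (x - t) \<and> a * (x - t) < \<eta>}"] by blast
    have "unicolored X (\<gamma> x)" using unicolored_iff[OF \<eta>(2)[OF x(1,2)]] eq by blast
    then have "X F = X G"
      using unicolored_imp_constant unicolored_everywhere[OF X x(3)] FG(1) unfolding adjacent_faces_def by blast
    then show False using FG(2) by blast
  qed
qed

end

lemma (in knot_diagram) odd_balanced: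
  assumes "\<And>p. p \<in> crossings K \<Longrightarrow> even (evaluate h (dehn_relator K p))"
  shows "balanced (\<lambda>F. odd (h F))"
  unfolding balanced_def
proof
  fix p assume "p \<in> crossings K"
  from assms[OF this]
show "(odd (h (corner K p 1 1)) = odd (h (corner K p 1 (-1)))) =
      (odd (h (corner K p (-1) 1)) = odd (h (corner K p (-1) (-1)))) \<and>
     (odd (h (corner K p 1 1)) = odd (h (corner K p (-1) 1))) =
      (odd (h (corner K p 1 (-1))) = odd (h (corner K p (-1) (-1))))"
    by (auto simp: dehn_relator_def)
qed

section \<open>Dehn matrices and the coloring module\<close>

locale dehn_matrix = knot_diagram K for K +
  fixes F0 U :: "complex set" and ps :: "complex list" and fs :: "complex set list" and M :: "int mat"
  assumes omissible: "omissible_face K F0"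
    and U: "U \<in> faces K" "\<not> bounded U"
    and ps: "distinct ps" "set ps = crossings K"
    and fs: "distinct fs" "set fs = BOT_faces K F0" "length fs = length ps"
    and M: "M = Matrix.mat (length ps) (length fs)
                  (\<lambda>(i, j). Poly_Mapping.lookup (dehn_relator K (ps ! i)) (fs ! j))"
begin

abbreviation "n \<equiv> length ps"
abbreviation "rel i \<equiv> dehn_relator K (ps ! i)"

lemma M_carrier: "M \<in> carrier_mat n n"
  using M fs by simp

lemma M_index: "i < n \<Longrightarrow> j < n \<Longrightarrow> M $$ (i, j) = Poly_Mapping.lookup (rel i) (fs ! j)"
  using M fs by simp

lemma F0_U: "F0 \<in> faces K" "bounded F0" "F0 \<noteq> U" "adjacent_faces K F0 U"
proof -
  show F: "F0 \<in> faces K" "bounded F0" using omissible by (auto simp: omissible_face_def)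
  show "F0 \<noteq> U" using F U by auto
  obtain U' where U': "\<not> bounded U'" "adjacent_faces K F0 U'" using omissible by (auto simp: omissible_face_def)
  then have "U' \<in> faces K" by (simp add: adjacent_faces_def)
  then have "U = U'" using unbounded_face_unique U U'(1) by blast
  then show "adjacent_faces K F0 U" using U'(2) by simp
qed

lemma faces_eq: "faces K = insert U (insert F0 (set fs))"
  using F0_U U unbounded_face_unique unfolding fs(2) BOT_faces_def by blast

lemma notin_fs: "F0 \<notin> set fs" "U \<notin> set fs"
  using U unfolding fs(2) BOT_faces_def by auto

lemma ps_crossing: "i < n \<Longrightarrow> ps ! i \<in> crossings K"
  using nth_mem[of i ps] ps(2) by simp

lemma fs_face: "j < n \<Longrightarrow> fs ! j \<in> faces K"
  using nth_mem[of j fs] faces_eq fs(3) by auto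

lemma crossing_ps: "p \<in> crossings K \<Longrightarrow> \<exists>i<n. p = ps ! i"
  using ps by (metis in_set_conv_nth)

lemma keys_relator: "p \<in> crossings K \<Longrightarrow> Poly_Mapping.keys (dehn_relator K p) \<subseteq> faces K"
  unfolding dehn_relator_def
  by (intro subset_trans[OF keys_diff] subset_trans[OF keys_add] Un_least) (simp_all add: corner_face)

lemma sum_fs: "(\<Sum>F\<in>set fs. f F) = (\<Sum>j<n. f (fs ! j))"
  using fs sum.reindex_bij_betw[OF bij_betw_nth[OF fs(1) refl refl]] by metis

lemma evaluate_faces:
  assumes "Poly_Mapping.keys c \<subseteq> faces K"
  shows "evaluate X c = (\<Sum>j<n. Poly_Mapping.lookup c (fs ! j) * X (fs ! j))
           + Poly_Mapping.lookup c F0 * X F0 + Poly_Mapping.lookup c U * X U"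
proof -
  have "finite (faces K)" using faces_eq by simp
  then show ?thesis
    using evaluate_superset[OF _ assms, of X] notin_fs F0_U(3) faces_eq sum_fs[of "\<lambda>F. Poly_Mapping.lookup c F * X F"]
    by (simp add: add.commute)
qed

lemma evaluate_relator:
  assumes "i < n"
  shows "evaluate X (rel i) = (\<Sum>j<n. M $$ (i, j) * X (fs ! j))
           + Poly_Mapping.lookup (rel i) F0 * X F0 + Poly_Mapping.lookup (rel i) U * X U"
  using evaluate_faces[OF keys_relator[OF ps_crossing[OF assms]]] M_index[OF assms] by simp


lemma crossing_relator_even:
  assumes "\<And>i. i < n \<Longrightarrow> even (evaluate h (rel i))"
  shows "balanced (\<lambda>F. odd (h F))"
proof (rule odd_balanced)
  show "even (evaluate h (dehn_relator K p))" if "p \<in> crossings K" for p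
    using crossing_ps[OF that] assms by blast
qed

text \<open>
  A kernel vector of \<open>M\<close> modulo \<open>2\<close>, extended by \<open>0\<close> to the
  omitted and the unbounded face, is a balanced coloring that agrees on these two adjacent faces,
  so it is constantly even.
\<close>

lemma det_odd: "odd (Determinant.det M)"
proof
  assume ev: "even (Determinant.det M)"
  show False
  proof (rule even_det_kernel[OF M_carrier ev])
    fix u :: "nat \<Rightarrow> int"
    assume u: "\<exists>j<n. odd (u j)" "\<And>i. i < n \<Longrightarrow> even (\<Sum>j<n. M $$ (i, j) * u j)"
    obtain h where h: "\<And>j. j < n \<Longrightarrow> h (fs ! j) = u j" "\<And>F. F \<notin> set fs \<Longrightarrow> h F = 0"
      using extend_along_list[OF fs(1), of u "\<lambda>_. 0"] fs(3) by metis
    have "even (evaluate h (rel i))" if "i < n" for i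
      using u(2)[OF that] h notin_fs by (simp add: evaluate_relator[OF that])
    then have bal: "balanced (\<lambda>F. odd (h F))" by (rule crossing_relator_even)
    obtain j where j: "j < n" "odd (u j)" using u(1) by blast
    have "odd (h (fs ! j)) = odd (h U)"
      by (rule balanced_constant[OF bal F0_U(4) _ fs_face[OF j(1)] U(1)]) (simp add: h notin_fs)
    then show False using j h notin_fs by simp
  qed
qed

lemma det_nonzero: "Determinant.det M \<noteq> 0"
  using det_odd by auto

text \<open>
  Cramer's rule for the system that prescribes the value \<open>det M\<close> on the omitted face.
\<close>

lemma integer_kernel:
  obtains h where "h U = 0" "odd (h F0)" "\<And>i. i < n \<Longrightarrow> evaluate h (rel i) = 0"
proof -
  define r where "r i = Poly_Mapping.lookup (rel i) F0" for i
  obtain h where h: "\<And>j. j < n \<Longrightarrow> h (fs ! j) = - (\<Sum>i<n. cofactor M i j * r i)"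
    "\<And>F. F \<notin> set fs \<Longrightarrow> h F = (if F = F0 then Determinant.det M else 0)"
    using extend_along_list[OF fs(1), of "\<lambda>j. - (\<Sum>i<n. cofactor M i j * r i)"
        "\<lambda>F. if F = F0 then Determinant.det M else 0"] fs(3) by metis
  show thesis
  proof (rule that)
    show "h U = 0" "odd (h F0)" using h(2) notin_fs F0_U(3) det_odd by simp_all
    fix i assume i: "i < n"
    have "(\<Sum>j<n. M $$ (i, j) * h (fs ! j)) = - (\<Sum>j<n. \<Sum>k<n. M $$ (i, j) * cofactor M k j * r k)"
      by (simp add: h(1) sum_distrib_left sum_negf mult.assoc)
    also have "(\<Sum>j<n. \<Sum>k<n. M $$ (i, j) * cofactor M k j * r k)
        = (\<Sum>k<n. (\<Sum>j<n. M $$ (i, j) * cofactor M k j) * r k)"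
      by (subst sum.swap) (simp add: sum_distrib_right)
    also have "\<dots> = (\<Sum>k<n. (if i = k then Determinant.det M else 0) * r k)"
      using sum_mult_adj(1)[OF M_carrier i] by (intro sum.cong) auto
    also have "\<dots> = Determinant.det M * r i" using i by (simp add: if_distrib[of "\<lambda>x. x * _"] cong: if_cong)
    finally show "evaluate h (rel i) = 0"
      using h(2) notin_fs F0_U(3) by (simp add: evaluate_relator[OF i] r_def)
  qed
qed

text \<open>
  The parities of an integer solution of the Dehn relations with odd value at \<open>F0\<close>
  differ across every piece of the curve. Read as the integers \<open>0\<close> and
  \<open>1\<close> they sum to \<open>1\<close> along every strand, so they satisfy the Dehn
  relations over the integers.
\<close>

lemma checkerboard:
  obtains g where "g U = 0" "\<And>F. omissible_face K F \<Longrightarrow> g F = 1"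
    "\<And>i. i < n \<Longrightarrow> evaluate g (rel i) = 0"
proof -
  obtain h where h: "h U = 0" "odd (h F0)" "\<And>i. i < n \<Longrightarrow> evaluate h (rel i) = 0"
    using integer_kernel by blast
  have bal: "balanced (\<lambda>F. odd (h F))" using h(3) by (intro crossing_relator_even) simp
  have ne: "odd (h F0) \<noteq> odd (h U)" using h by simp
  note alt = balanced_checkerboard[OF bal F0_U(4) ne]
  define g where "g F = (if odd (h F) then 1 else 0 :: int)" for F
  show thesis
  proof (rule that)
    show "g U = 0" using h by (simp add: g_def)
    show "g F = 1" if om: "omissible_face K F" for F
    proof -
      obtain U' where U': "\<not> bounded U'" "adjacent_faces K F U'" using om by (auto simp: omissible_face_def)
      then have "U' \<in> faces K" by (simp add: adjacent_faces_def)
      then have "U' = U" using unbounded_face_unique U U'(1) by blast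
      then show ?thesis using alt(1)[OF U'(2)] h(1) by (simp add: g_def)
    qed
    fix i assume i: "i < n"
    have "g (corner K (ps ! i) a 1) + g (corner K (ps ! i) a (-1)) = 1" if "a \<in> {1,-1}" for a
      using alt(2)[OF ps_crossing[OF i] that] by (simp add: g_def)
    from this[of 1] this[of "-1"] show "evaluate g (rel i) = 0" by (simp add: dehn_relator_def)
  qed
qed

text \<open>
  Only the column of \<open>F1\<close> is missing in \<open>M'\<close>. Since \<open>g\<close>
  satisfies the Dehn relations and \<open>g F1 = 1\<close>, that column is minus the combination
  of the other columns with coefficients \<open>g\<close>.
\<close>

lemma matrix_column_change:
  assumes "dehn_matrix K F1 U ps fs' M'"
  obtains Q where "Q \<in> carrier_mat n n" "M = M' * Q"
proof -
  interpret M': dehn_matrix K F1 U ps fs' M' by fact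
  obtain g where g: "g U = 0" "\<And>F. omissible_face K F \<Longrightarrow> g F = 1" "\<And>i. i < n \<Longrightarrow> evaluate g (rel i) = 0"
    using checkerboard by blast
  define Q where "Q = Matrix.mat n n (\<lambda>(k, j). if fs ! j = F1 then - g (fs' ! k) else if fs' ! k = fs ! j then 1 else 0)"
  have Q: "Q \<in> carrier_mat n n" by (simp add: Q_def)
  have "M $$ (i, j) = (\<Sum>k<n. M' $$ (i, k) * Q $$ (k, j))" if ij: "i < n" "j < n" for i j
  proof (cases "fs ! j = F1")
    case True
    have "(\<Sum>k<n. M' $$ (i, k) * Q $$ (k, j)) = - (\<Sum>k<n. M' $$ (i, k) * g (fs' ! k))"
      using ij True by (simp add: Q_def sum_negf)
    also have "\<dots> = Poly_Mapping.lookup (rel i) F1"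
      using M'.evaluate_relator[OF ij(1), of g] g(1) g(2)[OF M'.omissible] g(3)[OF ij(1)] by simp
    finally show ?thesis using M_index[OF ij] True by simp
  next
    case False
    have "fs ! j \<in> set fs" using ij fs(3) by simp
    then have "fs ! j \<noteq> U" using notin_fs by auto
    then have "fs ! j \<in> set fs'" using fs_face[OF ij(2)] M'.faces_eq False by blast
    then obtain k where k: "k < n" "fs' ! k = fs ! j" using M'.fs(3) by (metis in_set_conv_nth)
    have uniq: "fs' ! k' = fs ! j \<longleftrightarrow> k' = k" if "k' < n" for k'
      using k that M'.fs nth_eq_iff_index_eq by metis
    have "(\<Sum>k<n. M' $$ (i, k) * Q $$ (k, j)) = (\<Sum>k'<n. if k' = k then M' $$ (i, k') else 0)"
      using ij False uniq by (intro sum.cong) (auto simp: Q_def)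
    also have "\<dots> = M' $$ (i, k)" using k by simp
    finally show ?thesis using M_index[OF ij] M'.M_index[OF ij(1) k(1)] k(2) by simp
  qed
  then have "M = M' * Q"
    using M_carrier M'.M_carrier Q by (intro eq_matI) (simp_all add: scalar_prod_def atLeast0LessThan)
  then show thesis using that Q by blast
qed

abbreviation "face_group \<equiv> free_Abelian_group (faces K)"
abbreviation "relations \<equiv> generate face_group (dehn_relator K ` crossings K \<union> {frag_of U |U. U \<in> faces K \<and> \<not> bounded U})"

lemma relations_subgroup: "subgroup relations face_group"
proof (rule group.generate_is_subgroup[OF group_free_Abelian_group])
  show "dehn_relator K ` crossings K \<union> {frag_of U |U. U \<in> faces K \<and> \<not> bounded U} \<subseteq> carrier face_group"
    using keys_relator by auto
qed

lemma relations_closed: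
  shows "x \<in> relations \<Longrightarrow> y \<in> relations \<Longrightarrow> x + y \<in> relations" and "x \<in> relations \<Longrightarrow> frag_cmul k x \<in> relations" and "0 \<in> relations"
proof -
  show add: "x \<in> relations \<Longrightarrow> y \<in> relations \<Longrightarrow> x + y \<in> relations" for x y
    using subgroup.m_closed[OF relations_subgroup] by simp
  show "0 \<in> relations" using subgroup.one_closed[OF relations_subgroup] by simp
  show "frag_cmul k x \<in> relations" if "x \<in> relations"
  proof -
    have "Poly_Mapping.keys x \<subseteq> faces K" using subgroup.mem_carrier[OF relations_subgroup that] by simp
    then show ?thesis
      using group.subgroup_int_pow_closed[OF group_free_Abelian_group relations_subgroup that, of k] by simp
  qed
qed

lemma relations_sum: "(\<And>i. i \<in> I \<Longrightarrow> c i \<in> relations) \<Longrightarrow> sum c I \<in> relations"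
  by (induction I rule: infinite_finite_induct) (auto intro: relations_closed)

lemma relations_generators: "i < n \<Longrightarrow> rel i \<in> relations" "frag_of U \<in> relations"
  using ps_crossing U by (auto intro!: generate.incl)

text \<open>
  With \<open>d = 0\<close> this says that a labelling which satisfies the relations vanishes on
  the subgroup they generate.
\<close>

lemma dvd_evaluate_relations:
  assumes "\<And>i. i < n \<Longrightarrow> d dvd evaluate X (rel i)" "d dvd X U" "x \<in> relations"
  shows "d dvd evaluate X x"
proof -
  have gen: "d dvd evaluate X y" "Poly_Mapping.keys y \<subseteq> faces K"
    if "y \<in> dehn_relator K ` crossings K \<union> {frag_of U |U. U \<in> faces K \<and> \<not> bounded U}" for y
    using that
  proof (auto)
    show "d dvd evaluate X (dehn_relator K p)" if "p \<in> crossings K" for p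
      using crossing_ps[OF that] assms(1) by blast
    show "d dvd X V" if "V \<in> faces K" "\<not> bounded V" for V
      using unbounded_face_unique[OF that(1) U(1) that(2) U(2)] assms(2) by simp
  qed (use keys_relator in blast)
  from assms(3) show ?thesis
  proof (induction rule: generate.induct)
    case (inv h)
    then show ?case using gen[OF inv] by simp
  qed (use gen in auto)
qed

text \<open>
  Such an element is a combination of \<open>F0\<close> and \<open>U\<close>, and \<open>g\<close>
  shows that the coefficient of \<open>F0\<close> is zero.
\<close>

lemma in_relations_if_zero_on_fs:
  assumes g: "g U = 0" "g F0 = 1"
    and z: "Poly_Mapping.keys z \<subseteq> faces K" "\<And>j. j < n \<Longrightarrow> Poly_Mapping.lookup z (fs ! j) = 0"
      "evaluate g z = 0"
  shows "z \<in> relations"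
proof -
  have 0: "Poly_Mapping.lookup z F0 = 0" using evaluate_faces[OF z(1), of g] g z(2,3) by simp
  have "z = frag_cmul (Poly_Mapping.lookup z U) (frag_of U)"
  proof (rule poly_mapping_eqI)
    fix F
    show "Poly_Mapping.lookup z F = Poly_Mapping.lookup (frag_cmul (Poly_Mapping.lookup z U) (frag_of U)) F"
    proof (cases "F \<in> faces K")
      case True
      then consider "F = U" | "F = F0" | "F \<in> set fs" using faces_eq by blast
      then show ?thesis
      proof cases
        case 3
        then obtain j where "j < n" "F = fs ! j" using fs(3) by (metis in_set_conv_nth)
        moreover have "F \<noteq> U" using 3 notin_fs(2) by blast
        ultimately show ?thesis using z(2) by simp
      qed (use 0 F0_U(3) in simp_all)
    next
      case False
      then have "F \<notin> Poly_Mapping.keys z" "F \<noteq> U" using z(1) U(1) by auto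
      then show ?thesis by (simp add: in_keys_iff)
    qed
  qed
  moreover have "frag_cmul (Poly_Mapping.lookup z U) (frag_of U) \<in> relations"
    by (rule relations_closed(2)) (rule relations_generators)
  ultimately show ?thesis by simp
qed

text \<open>
  The unit cofactor makes \<open>pin_row M i0 j0\<close> invertible over the integers: the
  relations other than that of \<open>ps ! i0\<close>, together with the unit vector at \<open>fs
  ! j0\<close>, span all labels on \<open>fs\<close>. So every element killed by \<open>g\<close>
  is congruent to a multiple of \<open>\<tau>\<close>, the face \<open>fs ! j0\<close> corrected
  by a multiple of \<open>F0\<close> so that \<open>g\<close> kills it. The order of
  \<open>\<tau>\<close> is bounded above by row \<open>j0\<close> of the adjugate, which combines
  the relations to \<open>det M\<close> times the unit vector, and below by its column
  \<open>i0\<close>, which is a labelling that satisfies the relations modulo \<open>det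
  M\<close>.
\<close>

lemma torsion_cyclic:
  assumes ij: "i0 < n" "j0 < n" and unit: "\<bar>cofactor M i0 j0\<bar> = 1"
  shows "cyclic_group (coloring_torsion_module K)" and "int (knot_det K) = \<bar>Determinant.det M\<bar>"
proof -
  obtain g where g: "g U = 0" "g F0 = 1" "\<And>i. i < n \<Longrightarrow> evaluate g (rel i) = 0"
    using checkerboard omissible by metis
  define d where "d = nat \<bar>Determinant.det M\<bar>"
  define \<tau> where "\<tau> = frag_of (fs ! j0) - frag_cmul (g (fs ! j0)) (frag_of F0)"
  have g\<tau>: "evaluate g \<tau> = 0" using g by (simp add: \<tau>_def)
  have k\<tau>: "Poly_Mapping.keys \<tau> \<subseteq> faces K"
    unfolding \<tau>_def using fs_face[OF ij(2)] F0_U(1)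
    by (intro subset_trans[OF keys_diff] Un_least subset_trans[OF keys_cmul]) auto
  have fsj: "fs ! j \<noteq> F0" "fs ! j = fs ! j0 \<longleftrightarrow> j = j0" if "j < n" for j
    using that ij fs notin_fs(1) nth_mem[of j fs] by (auto simp: nth_eq_iff_index_eq)
  have l\<tau>: "Poly_Mapping.lookup \<tau> (fs ! j) = (if j = j0 then 1 else 0)" if "j < n" for j
    using fsj[OF that] by (simp add: \<tau>_def lookup_minus)
  \<comment> \<open>For elements killed by \<open>g\<close>, a congruence modulo the relations can be checked on \<open>fs\<close>.\<close>
  have cong: "x - frag_cmul m \<tau> - (\<Sum>i<n. frag_cmul (c i) (rel i)) \<in> relations"
    if x: "Poly_Mapping.keys x \<subseteq> faces K" "evaluate g x = 0"
      and eq: "\<And>j. j < n \<Longrightarrow> Poly_Mapping.lookup x (fs ! j) = m * (if j = j0 then 1 else 0) + (\<Sum>i<n. c i * M $$ (i, j))"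
    for x m c
  proof (rule in_relations_if_zero_on_fs[OF g(1,2)])
    let ?s = "\<Sum>i<n. frag_cmul (c i) (rel i)"
    have "frag_cmul (c i) (rel i) \<in> carrier face_group" if "i < n" for i
      using keys_relator[OF ps_crossing[OF that]] keys_cmul subset_trans by fastforce
    then have "?s \<in> carrier face_group" by (intro sum_closed_free_Abelian_group) auto
    then show "Poly_Mapping.keys (x - frag_cmul m \<tau> - ?s) \<subseteq> faces K"
      using x(1) subset_trans[OF keys_cmul k\<tau>]
      by (intro subset_trans[OF keys_diff] Un_least) simp_all
    show "evaluate g (x - frag_cmul m \<tau> - ?s) = 0" using x(2) g\<tau> g(3) by simp
    fix j assume j: "j < n"
    have "Poly_Mapping.lookup ?s (fs ! j) = (\<Sum>i<n. c i * M $$ (i, j))"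
      using M_index[OF _ j] by (simp add: lookup_sum)
    then show "Poly_Mapping.lookup (x - frag_cmul m \<tau> - ?s) (fs ! j) = 0"
      using eq[OF j] l\<tau>[OF j] by (simp add: lookup_minus)
  qed
  have in_rel: "x - frag_cmul m \<tau> \<in> relations"
    if "Poly_Mapping.keys x \<subseteq> faces K" "evaluate g x = 0"
      "\<And>j. j < n \<Longrightarrow> Poly_Mapping.lookup x (fs ! j) = m * (if j = j0 then 1 else 0) + (\<Sum>i<n. c i * M $$ (i, j))"
    for x m c
  proof -
    have "(\<Sum>i<n. frag_cmul (c i) (rel i)) \<in> relations" by (rule relations_sum) (auto intro: relations_closed relations_generators)
    from relations_closed(1)[OF cong[OF that] this] show ?thesis by simp
  qed
  \<comment> \<open>By \<open>M * adj M = det M\<close>, this labelling satisfies all relations modulo \<open>det M\<close>.\<close>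
  obtain v where v: "\<And>j. j < n \<Longrightarrow> v (fs ! j) = cofactor M i0 j" "\<And>F. F \<notin> set fs \<Longrightarrow> v F = 0"
    using extend_along_list[OF fs(1), of "\<lambda>j. cofactor M i0 j" "\<lambda>_. 0"] fs(3) by metis
  have vrel: "Determinant.det M dvd evaluate v (rel i)" if "i < n" for i
    using sum_mult_adj(1)[OF M_carrier that ij(1)] v notin_fs by (simp add: evaluate_relator[OF that])
  have dM: "int d = \<bar>Determinant.det M\<bar>" by (simp add: d_def)
  have "cyclic_group (torsion_subgroup (face_group Mod relations)) \<and> card (carrier (torsion_subgroup (face_group Mod relations))) = d"
  proof (rule comm_group.cyclic_torsion_of_quotient[OF abelian_free_Abelian_group relations_subgroup,
        where g = "evaluate g" and \<phi> = "evaluate v" and \<tau> = \<tau>])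
    show "evaluate g x = 0" if "x \<in> relations" for x
      using dvd_evaluate_relations[of 0 g x] g that by simp
    show "int d dvd evaluate v x" if "x \<in> relations" for x
      using dvd_evaluate_relations[of "Determinant.det M" v x] vrel v(2) notin_fs that dM by simp
    show "\<tau> \<in> carrier face_group" using k\<tau> by simp
    show "is_unit (evaluate v \<tau>)" using unit v notin_fs ij by (simp add: \<tau>_def)
    show "0 < d" using det_nonzero by (simp add: d_def)
    show "\<tau> [^]\<^bsub>face_group\<^esub> d \<in> relations"
    proof -
      \<comment> \<open>The sign turns \<open>det M\<close> into the positive integer \<open>d\<close>.\<close>
      let ?s = "sgn (Determinant.det M)"
      have "frag_cmul (int d) \<tau> - frag_cmul 0 \<tau> \<in> relations"
      proof (rule in_rel)
        show "Poly_Mapping.keys (frag_cmul (int d) \<tau>) \<subseteq> faces K" using k\<tau> keys_cmul by blast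
        show "evaluate g (frag_cmul (int d) \<tau>) = 0" using g\<tau> by simp
        fix j assume j: "j < n"
        have "(\<Sum>i<n. ?s * cofactor M i j0 * M $$ (i, j)) = ?s * (if j0 = j then Determinant.det M else 0)"
          using sum_mult_adj(2)[OF M_carrier ij(2) j] by (simp add: mult.assoc flip: sum_distrib_left)
        then show "Poly_Mapping.lookup (frag_cmul (int d) \<tau>) (fs ! j)
            = 0 * (if j = j0 then 1 else 0) + (\<Sum>i<n. (?s * cofactor M i j0) * M $$ (i, j))"
          using l\<tau>[OF j] dM by (simp add: abs_sgn mult.commute)
      qed
      then show ?thesis by simp
    qed
    fix x assume x: "x \<in> carrier face_group" "evaluate g x = 0"
    let ?B = "pin_row M i0 j0"
    define \<epsilon> where "\<epsilon> = Determinant.det ?B"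
    have B: "?B \<in> carrier_mat n n" using M_carrier by (simp add: pin_row_def)
    have \<epsilon>: "\<epsilon> * \<epsilon> = 1"
      using det_pin_row[OF M_carrier ij] unit unfolding \<epsilon>_def by (metis abs_mult_self_eq mult_1)
    have Bij: "?B $$ (i, j) = (if i = i0 then (if j = j0 then 1 else 0) else M $$ (i, j))" if "i < n" "j < n" for i j
      using that M_carrier by (simp add: pin_row_def)
    \<comment> \<open>The coordinates of \<open>x\<close> in the rows of \<open>?B\<close>, whose inverse is \<open>\<epsilon>\<close> times its adjugate.\<close>
    define y where "y i = \<epsilon> * (\<Sum>k<n. Poly_Mapping.lookup x (fs ! k) * cofactor ?B i k)" for i
    have xy: "Poly_Mapping.lookup x (fs ! j) = (\<Sum>i<n. y i * ?B $$ (i, j))" if j: "j < n" for j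
    proof -
      have "(\<Sum>i<n. y i * ?B $$ (i, j))
          = \<epsilon> * (\<Sum>i<n. \<Sum>k<n. Poly_Mapping.lookup x (fs ! k) * (cofactor ?B i k * ?B $$ (i, j)))"
        by (simp add: y_def sum_distrib_left sum_distrib_right mult.assoc)
      also have "(\<Sum>i<n. \<Sum>k<n. Poly_Mapping.lookup x (fs ! k) * (cofactor ?B i k * ?B $$ (i, j)))
          = (\<Sum>k<n. Poly_Mapping.lookup x (fs ! k) * (\<Sum>i<n. cofactor ?B i k * ?B $$ (i, j)))"
        by (subst sum.swap) (simp add: sum_distrib_left)
      also have "\<dots> = (\<Sum>k<n. if k = j then Poly_Mapping.lookup x (fs ! k) * \<epsilon> else 0)"
        using sum_mult_adj(2)[OF B _ j] by (intro sum.cong) (auto simp: \<epsilon>_def)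
      also have "\<dots> = Poly_Mapping.lookup x (fs ! j) * \<epsilon>" using j by simp
      finally show ?thesis using \<epsilon> by (simp add: mult.left_commute)
    qed
    have "x - frag_cmul (y i0) \<tau> \<in> relations"
    proof (rule in_rel[of x "y i0" "\<lambda>i. if i = i0 then 0 else y i"])
      show "Poly_Mapping.keys x \<subseteq> faces K" "evaluate g x = 0" using x by simp_all
      fix j assume j: "j < n"
      have "(\<Sum>i<n. y i * ?B $$ (i, j)) = y i0 * ?B $$ (i0, j) + (\<Sum>i\<in>{..<n} - {i0}. y i * ?B $$ (i, j))"
        using ij(1) by (subst sum.remove[of _ i0]) auto
      also have "(\<Sum>i\<in>{..<n} - {i0}. y i * ?B $$ (i, j)) = (\<Sum>i<n. (if i = i0 then 0 else y i) * M $$ (i, j))"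
        using j ij by (subst sum.remove[of "{..<n}" i0]) (auto intro!: sum.cong simp: Bij)
      finally show "Poly_Mapping.lookup x (fs ! j)
          = y i0 * (if j = j0 then 1 else 0) + (\<Sum>i<n. (if i = i0 then 0 else y i) * M $$ (i, j))"
        using xy[OF j] Bij[OF ij(1) j] by simp
    qed
    moreover have "\<tau> [^]\<^bsub>face_group\<^esub> y i0 = frag_cmul (y i0) \<tau>" using k\<tau> by simp
    moreover have "inv\<^bsub>face_group\<^esub> (frag_cmul (y i0) \<tau>) = - frag_cmul (y i0) \<tau>"
      using k\<tau> keys_cmul by (intro inv_free_Abelian_group) blast
    ultimately show "\<exists>m::int. x \<otimes>\<^bsub>face_group\<^esub> inv\<^bsub>face_group\<^esub> (\<tau> [^]\<^bsub>face_group\<^esub> m) \<in> relations"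
      by (intro exI[of _ "y i0"]) (simp del: minus_frag_cmul)
  qed (use g\<tau> evaluate_hom in auto)
  then show "cyclic_group (coloring_torsion_module K)" "int (knot_det K) = \<bar>Determinant.det M\<bar>"
    using dM by (simp_all add: knot_det_def coloring_torsion_module_def coloring_module_def Let_def)
qed

end

text \<open>
  In a reduced diagram the four corners are distinct, so no coefficients add up or cancel.
\<close>

lemma (in knot_diagram) relator_coefficient:
  assumes red: "reduced_diagram K" and p: "p \<in> crossings K" and F: "F \<in> faces K"
  shows "p \<in> frontier F \<Longrightarrow> \<bar>Poly_Mapping.lookup (dehn_relator K p) F\<bar> = 1"
    and "p \<notin> frontier F \<Longrightarrow> Poly_Mapping.lookup (dehn_relator K p) F = 0"
proof -
  have inj: "inj_on (\<lambda>(a, b). corner K p a b) ({1, -1} \<times> {1, -1})"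
    using red p by (simp add: reduced_diagram_def)
  have eq: "corner K p a b = corner K p a' b' \<longleftrightarrow> a = a' \<and> b = b'"
    if "a \<in> {1,-1}" "b \<in> {1,-1}" "a' \<in> {1,-1}" "b' \<in> {1,-1}" for a b a' b'
    using inj_on_eq_iff[OF inj, of "(a, b)" "(a', b')"] that by auto
  have lookup: "Poly_Mapping.lookup (dehn_relator K p) F
      = (if F = corner K p (-1) 1 then 1 else 0) + (if F = corner K p (-1) (-1) then 1 else 0)
        - (if F = corner K p 1 1 then 1 else 0) - (if F = corner K p 1 (-1) then 1 else 0)"
    by (simp add: dehn_relator_def lookup_add lookup_minus)
  show "\<bar>Poly_Mapping.lookup (dehn_relator K p) F\<bar> = 1" if "p \<in> frontier F"
  proof -
    obtain a b where "a \<in> {1,-1}" "b \<in> {1,-1}" "F = corner K p a b"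
      using incident_iff_corner[OF p F] \<open>p \<in> frontier F\<close> by blast
    then show ?thesis unfolding lookup by (elim insertE emptyE) (simp_all add: eq)
  qed
  show "Poly_Mapping.lookup (dehn_relator K p) F = 0" if "p \<notin> frontier F"
  proof -
    have "F \<noteq> corner K p a b" if "a \<in> {1,-1}" "b \<in> {1,-1}" for a b
      using incident_iff_corner[OF p F] \<open>p \<notin> frontier F\<close> that by blast
    then show ?thesis unfolding lookup by simp
  qed
qed

section \<open>Diagrams whose balanced overlaid Tait graph has a forcing edge\<close>

theorem theorem5p8:
  fixes K :: space_curve and k :: nat and F0 :: "complex set" and e :: "complex \<times> complex set"
  assumes "knot K" and "regular_projection K"
    and "reduced_diagram K" and "card (crossings K) = k"
    and "omissible_face K F0" and "forcing_edge (BOT_graph K F0) e"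
  shows "(\<forall>S. is_SNF_of_knot K S \<longleftrightarrow>
              S = mat_diag k (\<lambda>i. if Suc i = k then int (knot_det K) else 1)) \<and>
         cyclic_group (coloring_torsion_module K)"
proof -
  interpret knot_diagram K by unfold_locales fact+
  define E where "E = {(p, F). p \<in> crossings K \<and> F \<in> BOT_faces K F0 \<and> p \<in> frontier F}"
  have E: "E \<subseteq> crossings K \<times> BOT_faces K F0" by (auto simp: E_def)
  have forcing: "forcing_edge (crossings K, BOT_faces K F0, E) e"
    using assms(6) by (simp add: BOT_graph_def E_def)
  then obtain m where m: "dimer_covering (crossings K, BOT_faces K F0, E) m"
    by (auto simp: forcing_edge_def)
  note bij = dimer_covering_bij[OF m E]
  have fin: "finite (crossings K)" using assms(2) by (simp add: regular_projection_def)
  then have finB: "finite (BOT_faces K F0)"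
    using bij_betw_finite[OF bij(1)] bij_betw_finite[OF bij(2)] by simp
  have cardB: "card (BOT_faces K F0) = k"
    using bij_betw_same_card[OF bij(1)] bij_betw_same_card[OF bij(2)] assms(4) by simp
  obtain U where U: "U \<in> faces K" "\<not> bounded U"
    using assms(5) unfolding omissible_face_def adjacent_faces_def by blast
  \<comment> \<open>The dimer covering counts the bounded faces, so the Dehn matrix of any omissible face is square.\<close>
  have cardB': "card (BOT_faces K F1) = k" if "omissible_face K F1" for F1
  proof -
    have "insert F1 (BOT_faces K F1) = insert F0 (BOT_faces K F0)"
      using that assms(5) by (auto simp: BOT_faces_def omissible_face_def)
    moreover have "F1 \<notin> BOT_faces K F1" "F0 \<notin> BOT_faces K F0" by (simp_all add: BOT_faces_def)
    moreover from calculation have "finite (BOT_faces K F1)" using finB by (metis finite_insert)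
    ultimately show ?thesis using finB cardB by (metis card_insert_disjoint nat.inject)
  qed
  have main: "smith_normal_form M1 = mat_diag k (\<lambda>i. if Suc i = k then int (knot_det K) else 1) \<and>
      cyclic_group (coloring_torsion_module K)"
    if F1: "omissible_face K F1" and ps: "distinct ps" "set ps = crossings K"
      and fs1: "distinct fs1" "set fs1 = BOT_faces K F1"
      and M1: "M1 = Matrix.mat (length ps) (length fs1)
                    (\<lambda>(i, j). Poly_Mapping.lookup (dehn_relator K (ps ! i)) (fs1 ! j))"
    for F1 ps fs1 M1
  proof -
    have len: "length ps = k" "length fs1 = k"
      using distinct_card[OF ps(1)] distinct_card[OF fs1(1)] ps(2) fs1(2) assms(4) cardB'[OF F1] by auto
    obtain fs where fs: "set fs = BOT_faces K F0" "distinct fs" using finite_distinct_list[OF finB] by blast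
    have lenfs: "length fs = k" using distinct_card[OF fs(2)] fs(1) cardB by simp
    define M where "M = Matrix.mat (length ps) (length fs)
                    (\<lambda>(i, j). Poly_Mapping.lookup (dehn_relator K (ps ! i)) (fs ! j))"
    interpret D: dehn_matrix K F0 U ps fs M
      by unfold_locales (use assms(5) U ps fs len lenfs M_def in simp_all)
    interpret D1: dehn_matrix K F1 U ps fs1 M1
      by unfold_locales (use F1 U ps fs1 len M1 in simp_all)
    have Mk: "M \<in> carrier_mat k k" "M1 \<in> carrier_mat k k"
      using D.M_carrier D1.M_carrier len by simp_all
    have adj: "\<bar>M $$ (i, j)\<bar> = 1" if "i < k" "j < k" "(ps ! i, fs ! j) \<in> E" for i j
      using relator_coefficient(1)[OF assms(3) D.ps_crossing D.fs_face, of i j] that D.M_index[of i j] len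
      by (simp add: E_def)
    have nonadj: "M $$ (i, j) = 0" if "i < k" "j < k" "(ps ! i, fs ! j) \<notin> E" for i j
    proof -
      have "fs ! j \<in> BOT_faces K F0" using that lenfs fs(1) nth_mem[of j fs] by simp
      then have "ps ! i \<notin> frontier (fs ! j)" using that D.ps_crossing[of i] len by (simp add: E_def)
      then show ?thesis
        using relator_coefficient(2)[OF assms(3) D.ps_crossing D.fs_face, of i j] that D.M_index[of i j] len
        by simp
    qed
    obtain i0 j0 where ij: "i0 < k" "j0 < k" and cof: "\<bar>cofactor M i0 j0\<bar> = 1"
      by (rule forcing_edge_cofactor[OF ps len(1) fs(2,1) lenfs Mk(1) E adj nonadj forcing])
    have tors: "cyclic_group (coloring_torsion_module K)" "int (knot_det K) = \<bar>Determinant.det M\<bar>"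
      using D.torsion_cyclic[of i0 j0] ij cof len by simp_all
    obtain Q where Q: "Q \<in> carrier_mat k k" "M = M1 * Q"
      using D.matrix_column_change[OF D1.dehn_matrix_axioms] len by auto
    obtain Q' where Q': "Q' \<in> carrier_mat k k" "M1 = M * Q'"
      using D1.matrix_column_change[OF D.dehn_matrix_axioms] len by auto
    have "Determinant.det M = Determinant.det M1 * Determinant.det Q"
      using det_mult[OF Mk(2) Q(1)] by (simp only: Q(2)[symmetric])
    moreover have "Determinant.det M1 = Determinant.det M * Determinant.det Q'"
      using det_mult[OF Mk(1) Q'(1)] by (simp only: Q'(2)[symmetric])
    ultimately have "Determinant.det M1 dvd Determinant.det M" "Determinant.det M dvd Determinant.det M1"
      by (metis dvd_triv_left, metis dvd_triv_left)
    then have det: "\<bar>Determinant.det M1\<bar> = int (knot_det K)"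
      unfolding tors(2) by (rule zdvd_antisym_abs)
    have "is_unit d" if d: "\<And>i j. i < k \<Longrightarrow> j < k \<Longrightarrow> d dvd cofactor M1 i j" for d
    proof -
      have nz: "Determinant.det (M1 * Q) \<noteq> 0" unfolding Q(2)[symmetric] by (rule D.det_nonzero)
      have "d dvd cofactor M i0 j0"
        using dvd_cofactor_mult[OF Mk(2) Q(1) nz d ij] by (simp only: Q(2)[symmetric])
      then have "d dvd \<bar>cofactor M i0 j0\<bar>" by simp
      then show ?thesis by (simp only: cof)
    qed
    then have "smith_normal_form M1 = mat_diag k (\<lambda>i. if Suc i = k then \<bar>Determinant.det M1\<bar> else 1)"
      by (rule smith_normal_form_coprime_cofactors[OF Mk(2)])
    then show ?thesis unfolding det using tors(1) by (rule conjI)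
  qed
  show ?thesis
  proof (intro conjI allI)
    obtain ps fs where "set ps = crossings K" "distinct ps" "set fs = BOT_faces K F0" "distinct fs"
      using finite_distinct_list[OF fin] finite_distinct_list[OF finB] by blast
    note can = main[OF assms(5) this(2,1) this(4,3) refl]
    show "cyclic_group (coloring_torsion_module K)" using can by blast
    show "is_SNF_of_knot K S \<longleftrightarrow> S = mat_diag k (\<lambda>i. if Suc i = k then int (knot_det K) else 1)" for S
    proof
      assume "is_SNF_of_knot K S"
      then show "S = mat_diag k (\<lambda>i. if Suc i = k then int (knot_det K) else 1)"
        unfolding is_SNF_of_knot_def is_dehn_matrix_def using main by blast
    next
      assume S: "S = mat_diag k (\<lambda>i. if Suc i = k then int (knot_det K) else 1)"
      show "is_SNF_of_knot K S"
        unfolding is_SNF_of_knot_def is_dehn_matrix_def S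
        using can assms(5) \<open>set ps = crossings K\<close> \<open>distinct ps\<close> \<open>set fs = BOT_faces K F0\<close> \<open>distinct fs\<close>
        by metis
    qed
  qed
qed

end
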